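(* Let $E=(E^0,E^1,r,s)$ be a countable directed graph and write $$E^0=\Big(\bigsqcup_{i\in\Delta}Z_i\Big)\sqcup R,$$ where $R=E^0\setminus(r(E^1)\cup s(E^1))$ is the set of isolated vertices and the $Z_i$ are the connected maximal subsets of $E^0$ contained in $r(E^1)\cup s(E^1)$. For $i\in\Delta$, let $E_i$ be the subgraph of $E$ with vertex set $Z_i$, edge set $r^{-1}(Z_i)\cup s^{-1}(Z_i)$, and range and source maps the restrictions of $r$ and $s$, and let $X_n^{(i)}$ denote the set of level $n$ vertices of $E_i$. Suppose that for each $i\in\Delta$ there is $m_i$ such that either $Z_i=\bigcup_{n=1}^{m_i}X_n^{(i)}$, or $Z_i=\bigcup_{n=1}^{m_i}X_n^{(i)}\sqcup\{\overline{v_i}\}$ for some vertex $\overline{v_i}$. Then each representation $\pi:C^*(E)\rightarrow B(H)$, where $H$ is a separable Hilbert space, is unitarily equivalent to a representation induced by an $E$-branching system.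
   Context: A directed graph $E=(E^0,E^1,r,s)$ consists of a set of vertices $E^0$, a set of edges $E^1$, and range and source maps $r,s:E^1\to E^0$. All graphs are countable ($E^0$ and $E^1$ are countable). Paths and connectedness (edge directions are ignored). A vertex $u$ and an edge $e$ are adjacent if $r(e)=u$ or $s(e)=u$. A path between $u,v\in E^0$ is a pair of sequences $(u_0u_1\dots u_n;e_1\dots e_n)$ of vertices $u_i$ and edges $e_j$ such that $e_i$ is adjacent to $u_{i-1}$ and $u_i$ (that is, joins them) for each $i\in\{1,\dots,n\}$, $u=u_0$, $v=u_n$, and $e_i\ne e_j$ for $i\neq j$. A subset $Z\subseteq E^0$ is connected if for each pair of distinct $u,v\in Z$ there is a path between $u$ and $v$; a connected $Z$ is maximal if whenever $v\in E^0$ and there is a path between $v$ and some $u\in Z$, then $v\in Z$. Levels. A vertex $v$ of a graph $E$ is extreme if $\#(r^{-1}(v)\cup s^{-1}(v))=1$ and there is no edge $e$ with $r(e)=v=s(e)$; the unique edge adjacent to an extreme vertex is called an extreme edge. Let $X_1,Y_1$ be the sets of extreme vertices and extreme edges of $E$ (assuming there is at least one extreme vertex), and let $\mathbb{E}_1$ be the graph with vertex set $E^0\setminus X_1$, edge set $E^1\setminus Y_1$ and restricted maps $r,s$. Inductively, as long as $\mathbb{E}_{n-1}$ has extreme vertices, $X_n$ and $Y_n$ are the (nonempty) sets of extreme vertices and extreme edges of $\mathbb{E}_{n-1}$, and $\mathbb{E}_n$ is the graph with vertex set $E^0\setminus(X_1\cup\dots\cup X_n)$, edge set $E^1\setminus(Y_1\cup\dots\cup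 Y_n)$ and restricted $r,s$. Elements of $X_n$ are the level $n$ vertices. $C^*(E)$ is the universal C*-algebra generated by projections $\{P_v\}_{v\in E^0}$ and partial isometries $\{S_e\}_{e\in E^1}$ with orthogonal ranges such that: the $P_v$ are mutually orthogonal; $S_e^*S_e=P_{r(e)}$ for each $e\in E^1$; $S_eS_e^*\le P_{s(e)}$ for each $e\in E^1$; $P_v=\sum_{e:s(e)=v}S_eS_e^*$ for every vertex $v$ with $0<\#\{e:s(e)=v\}<\infty$. A representation is a $*$-homomorphism into $B(H)$. Notation: for measurable sets $A,B$ in a measure space $(X,\mu)$, $B\subseteq A$ a.e. means $\mu(B\setminus A)=0$, and $A=B$ a.e. means $\mu(A\setminus B)=\mu(B\setminus A)=0$; for maps, $f=g$ a.e. means $\mu(\{x:f(x)\ne g(x)\})=0$. An $E$-branching system is a measure space $(X,\mu)$ with families of measurable subsets $\{R_e\}_{e\in E^1}$, $\{D_v\}_{v\in E^0}$ of $X$ and maps $f_e,f_e^{-1}$ such that: 1. $R_e\cap R_d=\emptyset$ a.e. for $d\ne e$ in $E^1$; 2. $D_u\cap D_v=\emptyset$ a.e. for $u\neq v$ in $E^0$; 3. $R_e\subseteq D_{s(e)}$ a.e. for each $e\in E^1$; 4. $D_v=\bigcup_{e:s(e)=v}R_e$ a.e. if $0<\#\{e\in E^1:s(e)=v\}<\infty$; 5. for each $e\in E^1$ there is a map $f_e:D_{r(e)}\to R_e$ such that $f_e(D_{r(e)})=R_e$ a.e. and the Radon-Nikodym derivative $\Phi_{f_e}$ of $\mu\circ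 f_e$ with respect to $\mu$ (in $D_{r(e)}$) exists and $\Phi_{f_e}>0$ $\mu$-a.e.; 6. for each such $f_e$ there is a map $f_e^{-1}:R_e\to D_{r(e)}$ such that $f_e\circ f_e^{-1}=\mathrm{Id}_{R_e}$ a.e. and $f_e^{-1}\circ f_e=\mathrm{Id}_{D_{r(e)}}$ a.e., and the Radon-Nikodym derivative $\Phi_{f_e^{-1}}$ of $\mu\circ f_e^{-1}$ with respect to $\mu$ (in $R_e$) exists. The representation induced by an $E$-branching system $(X,\mu)$ is the $*$-homomorphism $C^*(E)\to B(L^2(X,\mu))$ (known to exist) given by $S_e\mapsto\big(\phi\mapsto\chi_{R_e}\cdot\Phi_{f_e^{-1}}^{1/2}\cdot(\phi\circ f_e^{-1})\big)$ and $P_v\mapsto\big(\phi\mapsto\chi_{D_v}\phi\big)$.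
   Formalization: In the second alternative the remaining vertex v̄_i is also assumed to carry no loop; with a loop e there, a representation can have P_v̄ of rank one and S_e acting as the scalar i, which no E-branching system induces, so the printed claim fails. *)

theory Defs
  imports
    "HOL-Analysis.Analysis"
    "HOL-Algebra.Module"
    "Graph_Theory.Digraph"
begin

section \<open>Graphs, undirected connectedness and levels\<close>

text \<open>
  A directed graph $(E^0,E^1,r,s)$ is a \<^locale>\<open>wf_digraph\<close>: the source map $s$ is \<^const>\<open>tail\<close> and
  the range map $r$ is \<^const>\<open>head\<close>. Loops, parallel edges and infinitely many edges are allowed.
\<close>

definition joins :: "('v, 'e) pre_digraph \<Rightarrow> 'e \<Rightarrow> 'v \<Rightarrow> 'v \<Rightarrow> bool" where
  "joins E e u w \<longleftrightarrow>
     tail E e = u \<and> head E e = w \<or> tail E e = w \<and> head E e = u"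

definition undirected_path ::
  "('v, 'e) pre_digraph \<Rightarrow> 'v \<Rightarrow> 'v list \<Rightarrow> 'e list \<Rightarrow> 'v \<Rightarrow> bool" where
  "undirected_path E u us es v \<longleftrightarrow>
     length us = Suc (length es) \<and> set us \<subseteq> verts E \<and> set es \<subseteq> arcs E \<and> distinct es \<and>
     us ! 0 = u \<and> us ! length es = v \<and>
     (\<forall>i < length es. joins E (es ! i) (us ! i) (us ! Suc i))"

definition path_between :: "('v, 'e) pre_digraph \<Rightarrow> 'v \<Rightarrow> 'v \<Rightarrow> bool" where
  "path_between E u v \<longleftrightarrow> (\<exists>us es. undirected_path E u us es v)"

definition connected_vertices :: "('v, 'e) pre_digraph \<Rightarrow> 'v set \<Rightarrow> bool" where
  "connected_vertices E Z \<longleftrightarrow>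
     Z \<subseteq> verts E \<and> (\<forall>u\<in>Z. \<forall>v\<in>Z. u \<noteq> v \<longrightarrow> path_between E u v)"

definition connected_maximal :: "('v, 'e) pre_digraph \<Rightarrow> 'v set \<Rightarrow> bool" where
  "connected_maximal E Z \<longleftrightarrow>
     connected_vertices E Z \<and> (\<forall>v\<in>verts E. (\<exists>u\<in>Z. path_between E v u) \<longrightarrow> v \<in> Z)"

definition isolated_vertices :: "('v, 'e) pre_digraph \<Rightarrow> 'v set" where
  "isolated_vertices E = verts E - (head E ` arcs E \<union> tail E ` arcs E)"

definition subgraph_on :: "('v, 'e) pre_digraph \<Rightarrow> 'v set \<Rightarrow> ('v, 'e) pre_digraph" where
  "subgraph_on E Z =
     \<lparr> verts = Z, arcs = {e \<in> arcs E. head E e \<in> Z \<or> tail E e \<in> Z},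
       tail = tail E, head = head E \<rparr>"

text \<open>
  The theorem also uses this for the vertex that remains in a component after all levels have been
  removed: no loop is allowed there. For a loop $e$ at $v$, a representation can have $P_v$ of rank
  one with $S_e$ acting as the scalar $i$ on its range, while the operators induced by a branching
  system map nonnegative functions to nonnegative functions, so only nonnegative scalars can occur.
\<close>

definition loop_at :: "('v, 'e) pre_digraph \<Rightarrow> 'v \<Rightarrow> bool" where
  "loop_at E v \<longleftrightarrow> (\<exists>e\<in>arcs E. head E e = v \<and> tail E e = v)"

definition extreme_vertices :: "('v, 'e) pre_digraph \<Rightarrow> 'v set" where
  "extreme_vertices E =
     {v \<in> verts E. card (in_arcs E v \<union> out_arcs E v) = 1 \<and> \<not> loop_at E v}"

definition extreme_edges :: "('v, 'e) pre_digraph \<Rightarrow> 'e set" where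
  "extreme_edges E = (\<Union>v \<in> extreme_vertices E. in_arcs E v \<union> out_arcs E v)"

text \<open>
  \<open>peel E n\<close> is $\mathbb{E}_n$, with $\mathbb{E}_0 = E$. Once there are no extreme vertices left,
  the graph no longer changes and all further levels are empty.
\<close>

fun peel :: "('v, 'e) pre_digraph \<Rightarrow> nat \<Rightarrow> ('v, 'e) pre_digraph" where
  "peel E 0 = E"
| "peel E (Suc n) =
     \<lparr> verts = verts (peel E n) - extreme_vertices (peel E n),
       arcs = arcs (peel E n) - extreme_edges (peel E n),
       tail = tail E, head = head E \<rparr>"

text \<open>Levels are counted from 1; only the values at \<open>n \<ge> 1\<close> are meaningful.\<close>

definition level :: "('v, 'e) pre_digraph \<Rightarrow> nat \<Rightarrow> 'v set" where
  "level E n = extreme_vertices (peel E (n - 1))"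


section \<open>C*-algebras\<close>

text \<open>
  Algebras and Hilbert spaces have explicit carriers, so that one can quantify over them.
  Complex vector spaces are modules, in the sense of \<open>HOL-Algebra\<close>, over the following ring.
\<close>

definition complex_ring :: "complex ring" where
  "complex_ring = \<lparr> carrier = UNIV, mult = (*), one = 1, zero = 0, add = (+) \<rparr>"

lemma cring_complex_ring: "cring complex_ring"
proof (rule cringI)
  show "abelian_group complex_ring"
  proof (rule abelian_groupI)
    fix x assume "x \<in> carrier complex_ring"
    have "- x \<oplus>\<^bsub>complex_ring\<^esub> x = \<zero>\<^bsub>complex_ring\<^esub>"
      by (simp add: complex_ring_def)
    then show "\<exists>y\<in>carrier complex_ring. y \<oplus>\<^bsub>complex_ring\<^esub> x = \<zero>\<^bsub>complex_ring\<^esub>"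
      by (intro bexI[of _ "- x"]) (simp_all add: complex_ring_def)
  qed (simp_all add: complex_ring_def)
  show "comm_monoid complex_ring"
    by (rule comm_monoidI) (simp_all add: complex_ring_def)
qed (simp add: complex_ring_def distrib_right)

definition norm_limit :: "('a, 'm) ring_scheme \<Rightarrow> ('a \<Rightarrow> real) \<Rightarrow> (nat \<Rightarrow> 'a) \<Rightarrow> 'a \<Rightarrow> bool" where
  "norm_limit V nrm \<sigma> x \<longleftrightarrow> (\<lambda>n. nrm (\<sigma> n \<ominus>\<^bsub>V\<^esub> x)) \<longlonglongrightarrow> 0"

definition norm_complete :: "('a, 'm) ring_scheme \<Rightarrow> ('a \<Rightarrow> real) \<Rightarrow> bool" where
  "norm_complete V nrm \<longleftrightarrow>
     (\<forall>\<sigma>. range \<sigma> \<subseteq> carrier V \<and>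
        (\<forall>\<epsilon>>0. \<exists>N. \<forall>m\<ge>N. \<forall>n\<ge>N. nrm (\<sigma> m \<ominus>\<^bsub>V\<^esub> \<sigma> n) < \<epsilon>)
        \<longrightarrow> (\<exists>x\<in>carrier V. norm_limit V nrm \<sigma> x))"

text \<open>The fields \<open>one\<close> below are not used: the algebras need not be unital.\<close>

record 'a star_algebra = "(complex, 'a) module" +
  star :: "'a \<Rightarrow> 'a"
  anorm :: "'a \<Rightarrow> real"

locale cstar_algebra = module complex_ring A
  for A :: "('a, 'm) star_algebra_scheme" (structure) +
  assumes mult_closed: "\<lbrakk>x \<in> carrier A; y \<in> carrier A\<rbrakk> \<Longrightarrow> x \<otimes> y \<in> carrier A"
    and mult_assoc: "\<lbrakk>x \<in> carrier A; y \<in> carrier A; z \<in> carrier A\<rbrakk>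
          \<Longrightarrow> (x \<otimes> y) \<otimes> z = x \<otimes> (y \<otimes> z)"
    and mult_add_left: "\<lbrakk>x \<in> carrier A; y \<in> carrier A; z \<in> carrier A\<rbrakk>
          \<Longrightarrow> (x \<oplus> y) \<otimes> z = (x \<otimes> z) \<oplus> (y \<otimes> z)"
    and mult_add_right: "\<lbrakk>x \<in> carrier A; y \<in> carrier A; z \<in> carrier A\<rbrakk>
          \<Longrightarrow> x \<otimes> (y \<oplus> z) = (x \<otimes> y) \<oplus> (x \<otimes> z)"
    and smult_mult_left: "\<lbrakk>x \<in> carrier A; y \<in> carrier A\<rbrakk>
          \<Longrightarrow> (c \<odot> x) \<otimes> y = c \<odot> (x \<otimes> y)"
    and smult_mult_right: "\<lbrakk>x \<in> carrier A; y \<in> carrier A\<rbrakk>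
          \<Longrightarrow> x \<otimes> (c \<odot> y) = c \<odot> (x \<otimes> y)"
    and star_closed: "x \<in> carrier A \<Longrightarrow> star A x \<in> carrier A"
    and star_star: "x \<in> carrier A \<Longrightarrow> star A (star A x) = x"
    and star_add: "\<lbrakk>x \<in> carrier A; y \<in> carrier A\<rbrakk>
          \<Longrightarrow> star A (x \<oplus> y) = star A x \<oplus> star A y"
    and star_smult: "x \<in> carrier A \<Longrightarrow> star A (c \<odot> x) = cnj c \<odot> star A x"
    and star_mult: "\<lbrakk>x \<in> carrier A; y \<in> carrier A\<rbrakk>
          \<Longrightarrow> star A (x \<otimes> y) = star A y \<otimes> star A x"
    and anorm_nonneg: "x \<in> carrier A \<Longrightarrow> 0 \<le> anorm A x"
    and anorm_eq_zero: "x \<in> carrier A \<Longrightarrow> anorm A x = 0 \<longleftrightarrow> x = \<zero>"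
    and anorm_triangle: "\<lbrakk>x \<in> carrier A; y \<in> carrier A\<rbrakk>
          \<Longrightarrow> anorm A (x \<oplus> y) \<le> anorm A x + anorm A y"
    and anorm_smult: "x \<in> carrier A \<Longrightarrow> anorm A (c \<odot> x) = cmod c * anorm A x"
    and anorm_mult: "\<lbrakk>x \<in> carrier A; y \<in> carrier A\<rbrakk>
          \<Longrightarrow> anorm A (x \<otimes> y) \<le> anorm A x * anorm A y"
    and cstar_identity: "x \<in> carrier A \<Longrightarrow> anorm A (star A x \<otimes> x) = (anorm A x)\<^sup>2"
    and complete: "norm_complete A (anorm A)"

definition star_hom ::
  "('a, 'm) star_algebra_scheme \<Rightarrow> ('b, 'n) star_algebra_scheme \<Rightarrow> ('a \<Rightarrow> 'b) \<Rightarrow> bool" where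
  "star_hom A B \<phi> \<longleftrightarrow>
     \<phi> \<in> carrier A \<rightarrow> carrier B \<and>
     (\<forall>x\<in>carrier A. \<forall>y\<in>carrier A. \<phi> (x \<oplus>\<^bsub>A\<^esub> y) = \<phi> x \<oplus>\<^bsub>B\<^esub> \<phi> y) \<and>
     (\<forall>c. \<forall>x\<in>carrier A. \<phi> (c \<odot>\<^bsub>A\<^esub> x) = c \<odot>\<^bsub>B\<^esub> \<phi> x) \<and>
     (\<forall>x\<in>carrier A. \<forall>y\<in>carrier A. \<phi> (x \<otimes>\<^bsub>A\<^esub> y) = \<phi> x \<otimes>\<^bsub>B\<^esub> \<phi> y) \<and>
     (\<forall>x\<in>carrier A. \<phi> (star A x) = star B (\<phi> x))"

definition closed_star_subalgebra :: "('a, 'm) star_algebra_scheme \<Rightarrow> 'a set \<Rightarrow> bool" where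
  "closed_star_subalgebra A C \<longleftrightarrow>
     C \<subseteq> carrier A \<and> \<zero>\<^bsub>A\<^esub> \<in> C \<and>
     (\<forall>x\<in>C. \<forall>y\<in>C. x \<oplus>\<^bsub>A\<^esub> y \<in> C \<and> x \<otimes>\<^bsub>A\<^esub> y \<in> C) \<and>
     (\<forall>c. \<forall>x\<in>C. c \<odot>\<^bsub>A\<^esub> x \<in> C) \<and>
     (\<forall>x\<in>C. star A x \<in> C) \<and>
     (\<forall>\<sigma> x. range \<sigma> \<subseteq> C \<and> x \<in> carrier A \<and> norm_limit A (anorm A) \<sigma> x \<longrightarrow> x \<in> C)"

definition generates :: "('a, 'm) star_algebra_scheme \<Rightarrow> 'a set \<Rightarrow> bool" where
  "generates A G \<longleftrightarrow> (\<forall>C. closed_star_subalgebra A C \<and> G \<subseteq> C \<longrightarrow> C = carrier A)"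

definition is_projection :: "('a, 'm) star_algebra_scheme \<Rightarrow> 'a \<Rightarrow> bool" where
  "is_projection A p \<longleftrightarrow> p \<in> carrier A \<and> star A p = p \<and> p \<otimes>\<^bsub>A\<^esub> p = p"

definition is_partial_isometry :: "('a, 'm) star_algebra_scheme \<Rightarrow> 'a \<Rightarrow> bool" where
  "is_partial_isometry A s \<longleftrightarrow> s \<in> carrier A \<and> s \<otimes>\<^bsub>A\<^esub> star A s \<otimes>\<^bsub>A\<^esub> s = s"

text \<open>The order of a C*-algebra, whose positive elements are those of the form $c^* c$.\<close>

definition cstar_le :: "('a, 'm) star_algebra_scheme \<Rightarrow> 'a \<Rightarrow> 'a \<Rightarrow> bool" where
  "cstar_le A a b \<longleftrightarrow> (\<exists>c\<in>carrier A. b \<ominus>\<^bsub>A\<^esub> a = star A c \<otimes>\<^bsub>A\<^esub> c)"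


section \<open>The C*-algebra of a graph\<close>

definition graph_family ::
  "('v, 'e) pre_digraph \<Rightarrow> ('a, 'm) star_algebra_scheme \<Rightarrow> ('v \<Rightarrow> 'a) \<Rightarrow> ('e \<Rightarrow> 'a) \<Rightarrow> bool" where
  "graph_family E A P S \<longleftrightarrow>
     (\<forall>v\<in>verts E. is_projection A (P v)) \<and>
     (\<forall>e\<in>arcs E. is_partial_isometry A (S e)) \<and>
     (\<forall>e\<in>arcs E. \<forall>d\<in>arcs E. e \<noteq> d \<longrightarrow>
        (S e \<otimes>\<^bsub>A\<^esub> star A (S e)) \<otimes>\<^bsub>A\<^esub> (S d \<otimes>\<^bsub>A\<^esub> star A (S d)) = \<zero>\<^bsub>A\<^esub>) \<and>
     (\<forall>u\<in>verts E. \<forall>v\<in>verts E. u \<noteq> v \<longrightarrow> P u \<otimes>\<^bsub>A\<^esub> P v = \<zero>\<^bsub>A\<^esub>) \<and>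
     (\<forall>e\<in>arcs E. star A (S e) \<otimes>\<^bsub>A\<^esub> S e = P (head E e)) \<and>
     (\<forall>e\<in>arcs E. cstar_le A (S e \<otimes>\<^bsub>A\<^esub> star A (S e)) (P (tail E e))) \<and>
     (\<forall>v\<in>verts E. finite (out_arcs E v) \<and> out_arcs E v \<noteq> {} \<longrightarrow>
        P v = (\<Oplus>\<^bsub>A\<^esub>e\<in>out_arcs E v. S e \<otimes>\<^bsub>A\<^esub> star A (S e)))"

text \<open>
  \<open>A\<close> with generators \<open>P\<close>, \<open>S\<close> is $C^*(E)$. HOL cannot quantify over the type of the elements of the
  algebra \<open>B\<close> in the universal property, so \<open>B\<close> ranges over all C*-algebras whose underlying set
  consists of sets of natural numbers. For countable \<open>E\<close> nothing is lost by this: the C*-algebra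
  generated by a countable family has at most continuum many elements, so it is isomorphic to one
  of that kind.
\<close>

definition is_graph_cstar_algebra ::
  "('v, 'e) pre_digraph \<Rightarrow> ('a, 'm) star_algebra_scheme \<Rightarrow> ('v \<Rightarrow> 'a) \<Rightarrow> ('e \<Rightarrow> 'a) \<Rightarrow> bool" where
  "is_graph_cstar_algebra E A P S \<longleftrightarrow>
     cstar_algebra A \<and> graph_family E A P S \<and>
     generates A (P ` verts E \<union> S ` arcs E) \<and>
     (\<forall>(B :: nat set star_algebra) Q T.
        cstar_algebra B \<and> graph_family E B Q T \<longrightarrow>
        (\<exists>\<phi>. star_hom A B \<phi> \<and> (\<forall>v\<in>verts E. \<phi> (P v) = Q v) \<and> (\<forall>e\<in>arcs E. \<phi> (S e) = T e)))"


section \<open>Hilbert spaces and representations\<close>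

text \<open>The inner product is linear in the first argument; the ring fields \<open>mult\<close> and \<open>one\<close> are
  not used.\<close>

record 'h inner_space = "(complex, 'h) module" +
  inner_prod :: "'h \<Rightarrow> 'h \<Rightarrow> complex"

definition hnorm :: "('h, 'm) inner_space_scheme \<Rightarrow> 'h \<Rightarrow> real" where
  "hnorm H x = sqrt (Re (inner_prod H x x))"

locale hilbert_space = module complex_ring H
  for H :: "('h, 'm) inner_space_scheme" (structure) +
  assumes inner_add_left: "\<lbrakk>x \<in> carrier H; y \<in> carrier H; z \<in> carrier H\<rbrakk>
          \<Longrightarrow> inner_prod H (x \<oplus> y) z = inner_prod H x z + inner_prod H y z"
    and inner_smult_left: "\<lbrakk>x \<in> carrier H; y \<in> carrier H\<rbrakk>
          \<Longrightarrow> inner_prod H (c \<odot> x) y = c * inner_prod H x y"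
    and inner_commute: "\<lbrakk>x \<in> carrier H; y \<in> carrier H\<rbrakk>
          \<Longrightarrow> inner_prod H x y = cnj (inner_prod H y x)"
    and inner_nonneg: "x \<in> carrier H \<Longrightarrow> 0 \<le> Re (inner_prod H x x)"
    and inner_eq_zero: "x \<in> carrier H \<Longrightarrow> inner_prod H x x = 0 \<longleftrightarrow> x = \<zero>"
    and complete: "norm_complete H (hnorm H)"

definition separable :: "('h, 'm) inner_space_scheme \<Rightarrow> bool" where
  "separable H \<longleftrightarrow>
     (\<exists>D\<subseteq>carrier H. countable D \<and> (\<forall>x\<in>carrier H. \<forall>\<epsilon>>0. \<exists>d\<in>D. hnorm H (x \<ominus>\<^bsub>H\<^esub> d) < \<epsilon>))"

definition linear_map ::
  "('h, 'm) inner_space_scheme \<Rightarrow> ('k, 'n) inner_space_scheme \<Rightarrow> ('h \<Rightarrow> 'k) \<Rightarrow> bool" where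
  "linear_map H K T \<longleftrightarrow>
     T \<in> carrier H \<rightarrow> carrier K \<and>
     (\<forall>x\<in>carrier H. \<forall>y\<in>carrier H. T (x \<oplus>\<^bsub>H\<^esub> y) = T x \<oplus>\<^bsub>K\<^esub> T y) \<and>
     (\<forall>c. \<forall>x\<in>carrier H. T (c \<odot>\<^bsub>H\<^esub> x) = c \<odot>\<^bsub>K\<^esub> T x)"

definition bounded_operator :: "('h, 'm) inner_space_scheme \<Rightarrow> ('h \<Rightarrow> 'h) \<Rightarrow> bool" where
  "bounded_operator H T \<longleftrightarrow>
     linear_map H H T \<and> (\<exists>K. \<forall>x\<in>carrier H. hnorm H (T x) \<le> K * hnorm H x)"

text \<open>
  A *-homomorphism from \<open>A\<close> to the bounded operators on \<open>H\<close>. Operators are compared on the carrier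
  of \<open>H\<close>; the last clause says that \<open>\<pi> (star A a)\<close> is the adjoint of \<open>\<pi> a\<close>.
\<close>

definition cstar_representation ::
  "('a, 'm) star_algebra_scheme \<Rightarrow> ('h, 'n) inner_space_scheme \<Rightarrow> ('a \<Rightarrow> 'h \<Rightarrow> 'h) \<Rightarrow> bool" where
  "cstar_representation A H \<pi> \<longleftrightarrow>
     (\<forall>a\<in>carrier A. bounded_operator H (\<pi> a)) \<and>
     (\<forall>a\<in>carrier A. \<forall>b\<in>carrier A. \<forall>x\<in>carrier H. \<pi> (a \<oplus>\<^bsub>A\<^esub> b) x = \<pi> a x \<oplus>\<^bsub>H\<^esub> \<pi> b x) \<and>
     (\<forall>c. \<forall>a\<in>carrier A. \<forall>x\<in>carrier H. \<pi> (c \<odot>\<^bsub>A\<^esub> a) x = c \<odot>\<^bsub>H\<^esub> \<pi> a x) \<and>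
     (\<forall>a\<in>carrier A. \<forall>b\<in>carrier A. \<forall>x\<in>carrier H. \<pi> (a \<otimes>\<^bsub>A\<^esub> b) x = \<pi> a (\<pi> b x)) \<and>
     (\<forall>a\<in>carrier A. \<forall>x\<in>carrier H. \<forall>y\<in>carrier H.
        inner_prod H (\<pi> a x) y = inner_prod H x (\<pi> (star A a) y))"

definition unitary_map ::
  "('h, 'm) inner_space_scheme \<Rightarrow> ('k, 'n) inner_space_scheme \<Rightarrow> ('h \<Rightarrow> 'k) \<Rightarrow> bool" where
  "unitary_map H K U \<longleftrightarrow>
     linear_map H K U \<and> bij_betw U (carrier H) (carrier K) \<and>
     (\<forall>x\<in>carrier H. \<forall>y\<in>carrier H. inner_prod K (U x) (U y) = inner_prod H x y)"

definition unitarily_equivalent ::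
  "('a, 'm) star_algebra_scheme \<Rightarrow> ('h, 'n) inner_space_scheme \<Rightarrow> ('a \<Rightarrow> 'h \<Rightarrow> 'h)
     \<Rightarrow> ('k, 'p) inner_space_scheme \<Rightarrow> ('a \<Rightarrow> 'k \<Rightarrow> 'k) \<Rightarrow> bool" where
  "unitarily_equivalent A H \<pi> K \<rho> \<longleftrightarrow>
     (\<exists>U. unitary_map H K U \<and> (\<forall>a\<in>carrier A. \<forall>x\<in>carrier H. U (\<pi> a x) = \<rho> a (U x)))"


section \<open>The Hilbert space of square-integrable functions\<close>

definition square_integrable :: "'x measure \<Rightarrow> ('x \<Rightarrow> complex) set" where
  "square_integrable M =
     {\<phi> \<in> borel_measurable M. integrable M (\<lambda>x. (cmod (\<phi> x))\<^sup>2)}"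

definition l2_class :: "'x measure \<Rightarrow> ('x \<Rightarrow> complex) \<Rightarrow> ('x \<Rightarrow> complex) set" where
  "l2_class M \<phi> = {\<psi> \<in> square_integrable M. AE x in M. \<psi> x = \<phi> x}"

definition l2_rep :: "('x \<Rightarrow> complex) set \<Rightarrow> 'x \<Rightarrow> complex" where
  "l2_rep F = (SOME \<phi>. \<phi> \<in> F)"

definition l2_space :: "'x measure \<Rightarrow> ('x \<Rightarrow> complex) set inner_space" where
  "l2_space M =
     \<lparr> carrier = l2_class M ` square_integrable M,
       mult = undefined,
       one = undefined,
       zero = l2_class M (\<lambda>_. 0),
       add = (\<lambda>F G. l2_class M (\<lambda>x. l2_rep F x + l2_rep G x)),
       smult = (\<lambda>c F. l2_class M (\<lambda>x. c * l2_rep F x)),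
       inner_prod = (\<lambda>F G. \<integral>x. l2_rep F x * cnj (l2_rep G x) \<partial>M) \<rparr>"


section \<open>Branching systems\<close>

text \<open>
  \<open>\<Phi>\<close> is a Radon-Nikodym derivative, with values in $[0,\infty)$, with respect to $\mu$ in \<open>A\<close> of
  $\mu\circ g$, the set function $C \mapsto \mu(g(C))$ on measurable subsets \<open>C\<close> of \<open>A\<close>.
  Measurability of \<open>g(C)\<close> must be demanded, since \<^const>\<open>emeasure\<close> is 0 on non-measurable sets.
\<close>

definition image_RN_deriv ::
  "'x measure \<Rightarrow> 'x set \<Rightarrow> ('x \<Rightarrow> 'x) \<Rightarrow> ('x \<Rightarrow> real) \<Rightarrow> bool" where
  "image_RN_deriv M A g \<Phi> \<longleftrightarrow>
     \<Phi> \<in> borel_measurable (restrict_space M A) \<and> (\<forall>x\<in>A. 0 \<le> \<Phi> x) \<and>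
     (\<forall>C\<in>sets M. C \<subseteq> A \<longrightarrow>
        g ` C \<in> sets M \<and> emeasure M (g ` C) = (\<integral>\<^sup>+x\<in>C. ennreal (\<Phi> x) \<partial>M))"

text \<open>
  The measure space is \<open>bs_measure\<close>, with $X$ its \<^const>\<open>space\<close>. The derivatives \<open>bs_Phi e\<close> of
  $\mu\circ f_e$ and \<open>bs_Phi_inv e\<close> of $\mu\circ f_e^{-1}$ are part of the data, because
  they determine the induced representation and are unique a.e. only under finiteness assumptions
  on the measure.
\<close>

record ('x, 'v, 'e) branching_data =
  bs_measure :: "'x measure"
  bs_R :: "'e \<Rightarrow> 'x set"
  bs_D :: "'v \<Rightarrow> 'x set"
  bs_f :: "'e \<Rightarrow> 'x \<Rightarrow> 'x"
  bs_f_inv :: "'e \<Rightarrow> 'x \<Rightarrow> 'x"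
  bs_Phi :: "'e \<Rightarrow> 'x \<Rightarrow> real"
  bs_Phi_inv :: "'e \<Rightarrow> 'x \<Rightarrow> real"

definition eq_ae :: "'x measure \<Rightarrow> 'x set \<Rightarrow> 'x set \<Rightarrow> bool" where
  "eq_ae M A B \<longleftrightarrow> A - B \<in> null_sets M \<and> B - A \<in> null_sets M"

locale branching_system =
  fixes E :: "('v, 'e) pre_digraph" and X :: "('x, 'v, 'e) branching_data"
  assumes R_measurable: "e \<in> arcs E \<Longrightarrow> bs_R X e \<in> sets (bs_measure X)"
    and D_measurable: "v \<in> verts E \<Longrightarrow> bs_D X v \<in> sets (bs_measure X)"
    and R_disjoint: "\<lbrakk>e \<in> arcs E; d \<in> arcs E; d \<noteq> e\<rbrakk>
          \<Longrightarrow> eq_ae (bs_measure X) (bs_R X e \<inter> bs_R X d) {}"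
    and D_disjoint: "\<lbrakk>u \<in> verts E; v \<in> verts E; u \<noteq> v\<rbrakk>
          \<Longrightarrow> eq_ae (bs_measure X) (bs_D X u \<inter> bs_D X v) {}"
    and R_subset_D: "e \<in> arcs E
          \<Longrightarrow> bs_R X e - bs_D X (tail E e) \<in> null_sets (bs_measure X)"
    and D_eq_Union_R: "\<lbrakk>v \<in> verts E; finite (out_arcs E v); out_arcs E v \<noteq> {}\<rbrakk>
          \<Longrightarrow> eq_ae (bs_measure X) (bs_D X v) (\<Union>e\<in>out_arcs E v. bs_R X e)"
    and f_measurable: "e \<in> arcs E \<Longrightarrow>
          bs_f X e \<in> restrict_space (bs_measure X) (bs_D X (head E e))
                    \<rightarrow>\<^sub>M restrict_space (bs_measure X) (bs_R X e)"
    and f_image: "e \<in> arcs E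
          \<Longrightarrow> eq_ae (bs_measure X) (bs_f X e ` bs_D X (head E e)) (bs_R X e)"
    and f_RN_deriv: "e \<in> arcs E
          \<Longrightarrow> image_RN_deriv (bs_measure X) (bs_D X (head E e)) (bs_f X e) (bs_Phi X e)"
    and f_RN_deriv_pos: "e \<in> arcs E
          \<Longrightarrow> AE x in bs_measure X. x \<in> bs_D X (head E e) \<longrightarrow> 0 < bs_Phi X e x"
    and f_inv_measurable: "e \<in> arcs E \<Longrightarrow>
          bs_f_inv X e \<in> restrict_space (bs_measure X) (bs_R X e)
                        \<rightarrow>\<^sub>M restrict_space (bs_measure X) (bs_D X (head E e))"
    and f_f_inv: "e \<in> arcs E
          \<Longrightarrow> AE x in bs_measure X. x \<in> bs_R X e \<longrightarrow> bs_f X e (bs_f_inv X e x) = x"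
    and f_inv_f: "e \<in> arcs E
          \<Longrightarrow> AE x in bs_measure X. x \<in> bs_D X (head E e) \<longrightarrow> bs_f_inv X e (bs_f X e x) = x"
    and f_inv_RN_deriv: "e \<in> arcs E
          \<Longrightarrow> image_RN_deriv (bs_measure X) (bs_R X e) (bs_f_inv X e) (bs_Phi_inv X e)"

definition induced_representation ::
  "('v, 'e) pre_digraph \<Rightarrow> ('a, 'm) star_algebra_scheme \<Rightarrow> ('v \<Rightarrow> 'a) \<Rightarrow> ('e \<Rightarrow> 'a)
     \<Rightarrow> ('x, 'v, 'e) branching_data
     \<Rightarrow> ('a \<Rightarrow> ('x \<Rightarrow> complex) set \<Rightarrow> ('x \<Rightarrow> complex) set) \<Rightarrow> bool" where
  "induced_representation E A P S X \<rho> \<longleftrightarrow>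
     cstar_representation A (l2_space (bs_measure X)) \<rho> \<and>
     (\<forall>e\<in>arcs E. \<forall>\<phi>\<in>square_integrable (bs_measure X).
        \<rho> (S e) (l2_class (bs_measure X) \<phi>) =
          l2_class (bs_measure X)
            (\<lambda>x. indicator (bs_R X e) x * complex_of_real (sqrt (bs_Phi_inv X e x))
                   * \<phi> (bs_f_inv X e x))) \<and>
     (\<forall>v\<in>verts E. \<forall>\<phi>\<in>square_integrable (bs_measure X).
        \<rho> (P v) (l2_class (bs_measure X) \<phi>) =
          l2_class (bs_measure X) (\<lambda>x. indicator (bs_D X v) x * \<phi> x))"

end

theory Submission
  imports Defs
begin

text \<open>
  A component that is exhausted by finitely many levels, up to one vertex without a loop, contains no
  infinite directed path: peeling off the extreme vertices removes at most the first edge of such a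
  path at a time (\<open>infinite_path_survives_peel\<close>).

  If there are no infinite directed paths, a representation can be diagonalized along finite paths.
  The range of a vertex projection \<open>P\<^sub>v\<close> is the orthogonal sum of the ranges of the \<open>S\<^sub>e\<close> with source \<open>v\<close>
  and a rest, the sink space of \<open>v\<close>. As \<open>S\<^sub>e\<close> is an isometry from the range of \<open>P\<^bsub>r(e)\<^esub>\<close>, each of the first
  summands can be decomposed in the same way, and well-founded induction shows that the range of \<open>P\<^sub>v\<close>
  is the orthogonal sum of the images \<open>S\<^sub>p V\<^sub>u\<close>, where \<open>p\<close> is a directed path from \<open>v\<close> to \<open>u\<close> and \<open>V\<^sub>u\<close> is the
  sink space of \<open>u\<close> (\<open>path_vectors_total\<close>, \<open>path_vector_orth\<close>). Choosing one orthonormal basis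
  for each sink space, and one for the orthogonal complement of all \<open>P\<^sub>v\<close>, gives an orthonormal basis
  of the whole space with two properties: every \<open>P\<^sub>v\<close> is the projection onto the span of a part \<open>D\<^sub>v\<close> of it,
  and \<open>S\<^sub>e\<close> maps \<open>D\<^bsub>r(e)\<^esub>\<close> bijectively onto a part \<open>R\<^sub>e\<close> of \<open>D\<^bsub>s(e)\<^esub>\<close>.

  The basis is countable by separability, so it can be regarded as a set of real numbers. With counting
  measure, the sets \<open>D\<^sub>v\<close> and \<open>R\<^sub>e\<close> and the bijections given by the \<open>S\<^sub>e\<close> form a branching system whose
  Radon-Nikodym derivatives are all 1 (\<open>branching_system_basis_system\<close>). The map that sends a
  vector to its coordinates is unitary (\<open>coordinate_map_unitary\<close>), and it transports the given
  representation to one for which the formulas of the induced representation hold on the generators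
  (\<open>equivalent_to_basis_system\<close>).
\<close>

section \<open>Orthonormal sets in a Hilbert space\<close>

definition orthonormal :: "('h, 'm) inner_space_scheme \<Rightarrow> 'h set \<Rightarrow> bool" where
  "orthonormal H B \<longleftrightarrow> B \<subseteq> carrier H \<and>
     (\<forall>b\<in>B. \<forall>c\<in>B. inner_prod H b c = (if b = c then 1 else 0))"

text \<open>
  For a closed subspace \<open>V\<close> this is the usual notion. Asking for maximality instead of density of the
  span makes sense for any set of vectors, and it avoids orthogonal projections onto \<open>V\<close>.
\<close>

definition orthonormal_basis_of :: "('h, 'm) inner_space_scheme \<Rightarrow> 'h set \<Rightarrow> 'h set \<Rightarrow> bool" where
  "orthonormal_basis_of H V B \<longleftrightarrow> orthonormal H B \<and> B \<subseteq> V \<and>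
     (\<forall>x\<in>V. (\<forall>b\<in>B. inner_prod H x b = 0) \<longrightarrow> x = \<zero>\<^bsub>H\<^esub>)"

context hilbert_space
begin

abbreviation ip where "ip \<equiv> inner_prod H"

lemma smult_carrier [simp, intro]: "x \<in> carrier H \<Longrightarrow> c \<odot> x \<in> carrier H"
  by (rule smult_closed) (simp_all add: complex_ring_def)

lemma zero_smult [simp]: "x \<in> carrier H \<Longrightarrow> 0 \<odot> x = \<zero>"
  using smult_l_null[of x] by (simp add: complex_ring_def)

lemma smult_zero [simp]: "c \<odot> \<zero> = \<zero>"
  by (rule smult_r_null) (simp add: complex_ring_def)

lemma inner_zero_left [simp]: "y \<in> carrier H \<Longrightarrow> ip \<zero> y = 0"
  using inner_smult_left[of \<zero> y 0] by simp

lemma inner_zero_right [simp]: "y \<in> carrier H \<Longrightarrow> ip y \<zero> = 0"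
  by (metis complex_cnj_zero inner_commute inner_zero_left zero_closed)

lemma inner_smult_right:
  "\<lbrakk>x \<in> carrier H; y \<in> carrier H\<rbrakk> \<Longrightarrow> ip x (c \<odot> y) = cnj c * ip x y"
  by (metis complex_cnj_mult inner_commute inner_smult_left smult_carrier)

lemma inner_diff_left:
  assumes "x \<in> carrier H" "y \<in> carrier H" "z \<in> carrier H"
  shows "ip (x \<ominus> y) z = ip x z - ip y z"
proof -
  have "(x \<ominus> y) \<oplus> y = x"
    using assms by (simp add: a_minus_def a_assoc l_neg)
  then show ?thesis
    using inner_add_left[of "x \<ominus> y" y z] assms by simp
qed

lemma inner_diff_right:
  assumes "x \<in> carrier H" "y \<in> carrier H" "z \<in> carrier H"
  shows "ip z (x \<ominus> y) = ip z x - ip z y"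
  using assms by (metis complex_cnj_diff inner_commute inner_diff_left minus_closed)

lemma inner_self: "x \<in> carrier H \<Longrightarrow> ip x x = complex_of_real ((hnorm H x)\<^sup>2)"
  using inner_nonneg[of x] arg_cong[OF inner_commute[of x x], of Im]
  by (simp add: hnorm_def complex_eq_iff)

lemma hnorm_nonneg [simp]: "x \<in> carrier H \<Longrightarrow> 0 \<le> hnorm H x"
  using inner_nonneg by (simp add: hnorm_def)

lemma hnorm_eq_zero: "x \<in> carrier H \<Longrightarrow> hnorm H x = 0 \<longleftrightarrow> x = \<zero>"
  using inner_eq_zero[of x] inner_self[of x] by simp

lemma diff_eq_zero_imp_eq:
  assumes "x \<in> carrier H" "y \<in> carrier H" "x \<ominus> y = \<zero>"
  shows "x = y"
proof -
  have "x = (x \<ominus> y) \<oplus> y"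
    using assms(1,2) by (simp add: a_minus_def a_assoc l_neg)
  then show ?thesis unfolding assms(3) using assms(2) by simp
qed

lemma eq_by_inner:
  assumes "x \<in> carrier H" "y \<in> carrier H" "\<And>w. w \<in> carrier H \<Longrightarrow> ip x w = ip y w"
  shows "x = y"
proof (rule diff_eq_zero_imp_eq)
  have "ip (x \<ominus> y) (x \<ominus> y) = 0" using assms by (simp add: inner_diff_left)
  then show "x \<ominus> y = \<zero>" using assms by (simp add: inner_eq_zero)
qed (use assms in auto)

lemma Cauchy_Schwarz:
  assumes x: "x \<in> carrier H" and y: "y \<in> carrier H"
  shows "cmod (ip x y) \<le> hnorm H x * hnorm H y"
proof (cases "y = \<zero>")
  case True
  then show ?thesis using x by simp
next
  case False
  then have pos: "hnorm H y > 0"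
    using hnorm_nonneg[OF y] hnorm_eq_zero[OF y] by (simp add: less_le)
  define c where "c = ip x y / ip y y"
  define z where "z = x \<ominus> c \<odot> y"
  have z: "z \<in> carrier H" using x y by (simp add: z_def)
  have "ip z y = 0"
  proof -
    have "ip y y \<noteq> 0" using False inner_eq_zero[OF y] by simp
    then show ?thesis using x y by (simp add: z_def inner_diff_left inner_smult_left c_def)
  qed
  then have "ip z z = ip z x"
    using inner_diff_right[OF x smult_carrier[OF y] z, of c] z y
    unfolding z_def[symmetric] by (simp add: inner_smult_right)
  also have "\<dots> = ip x x - c * ip y x"
    using x y by (simp add: z_def inner_diff_left inner_smult_left)
  also have "\<dots> = complex_of_real ((hnorm H x)\<^sup>2 - (cmod (ip x y))\<^sup>2 / (hnorm H y)\<^sup>2)"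
  proof -
    have "c * ip y x = complex_of_real ((cmod (ip x y))\<^sup>2) / complex_of_real ((hnorm H y)\<^sup>2)"
      unfolding complex_norm_square[of "ip x y"] using inner_commute[OF y x]
      by (simp add: c_def inner_self[OF y])
    then show ?thesis by (simp add: inner_self[OF x])
  qed
  finally have "0 \<le> (hnorm H x)\<^sup>2 - (cmod (ip x y))\<^sup>2 / (hnorm H y)\<^sup>2"
    using inner_nonneg[OF z] by simp
  then have "(cmod (ip x y))\<^sup>2 \<le> (hnorm H x * hnorm H y)\<^sup>2"
    using pos by (simp add: field_simps power_mult_distrib)
  then show ?thesis
    by (rule power2_le_imp_le) (use x y in simp)
qed

lemma tendsto_inner_left:
  assumes \<sigma>: "\<And>n. \<sigma> n \<in> carrier H" and lim: "norm_limit H (hnorm H) \<sigma> x"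
    and x: "x \<in> carrier H" and y: "y \<in> carrier H"
  shows "(\<lambda>n. ip (\<sigma> n) y) \<longlonglongrightarrow> ip x y"
proof -
  have "(\<lambda>n. hnorm H (\<sigma> n \<ominus> x) * hnorm H y) \<longlonglongrightarrow> 0 * hnorm H y"
    using lim unfolding norm_limit_def by (rule tendsto_mult_right)
  then have "(\<lambda>n. hnorm H (\<sigma> n \<ominus> x) * hnorm H y) \<longlonglongrightarrow> 0" by simp
  then have "(\<lambda>n. ip (\<sigma> n) y - ip x y) \<longlonglongrightarrow> 0"
  proof (rule tendsto_0_le[where K = 1])
    show "\<forall>\<^sub>F n in sequentially.
        norm (ip (\<sigma> n) y - ip x y) \<le> norm (hnorm H (\<sigma> n \<ominus> x) * hnorm H y) * 1"
      using Cauchy_Schwarz[of "\<sigma> _ \<ominus> x" y] \<sigma> x y by (simp add: inner_diff_left abs_mult)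
  qed
  then show ?thesis by (simp add: LIM_zero_iff)
qed

lemma inner_finsum_left:
  assumes "finite F" "f \<in> F \<rightarrow> carrier H" "y \<in> carrier H"
  shows "ip (\<Oplus>b\<in>F. f b) y = (\<Sum>b\<in>F. ip (f b) y)"
  using assms
proof (induction F rule: finite_induct)
  case (insert b F)
  then have "(\<Oplus>b\<in>F. f b) \<in> carrier H" by (intro finsum_closed) auto
  then show ?case using insert by (simp add: inner_add_left)
qed simp

text \<open>
  The maximal elements are found by Zorn's lemma; normalizing a vector of \<open>V\<close> orthogonal to a maximal
  orthonormal set would enlarge that set.
\<close>

lemma ex_orthonormal_basis_of:
  assumes V: "V \<subseteq> carrier H" and smult: "\<And>c x. x \<in> V \<Longrightarrow> c \<odot> x \<in> V"
  shows "\<exists>B. orthonormal_basis_of H V B"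
proof -
  define \<A> where "\<A> = {B. orthonormal H B \<and> B \<subseteq> V}"
  have "{} \<in> \<A>" by (simp add: \<A>_def orthonormal_def)
  moreover have "\<Union>\<C> \<in> \<A>" if "subset.chain \<A> \<C>" for \<C>
  proof -
    have "\<C> \<subseteq> \<A>" and chain: "\<And>X Y. \<lbrakk>X \<in> \<C>; Y \<in> \<C>\<rbrakk> \<Longrightarrow> X \<subseteq> Y \<or> Y \<subseteq> X"
      using that by (auto simp: subset_chain_def)
    moreover have "inner_prod H b c = (if b = c then 1 else 0)"
      if bc: "b \<in> \<Union>\<C>" "c \<in> \<Union>\<C>" for b c
    proof -
      obtain X where "X \<in> \<C>" "b \<in> X" "c \<in> X" using bc chain by blast
      then show ?thesis using \<open>\<C> \<subseteq> \<A>\<close> by (auto simp: \<A>_def orthonormal_def)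
    qed
    ultimately show ?thesis
      by (auto simp: \<A>_def orthonormal_def)
  qed
  ultimately obtain B where B: "B \<in> \<A>" and maximal: "\<And>X. \<lbrakk>X \<in> \<A>; B \<subseteq> X\<rbrakk> \<Longrightarrow> X = B"
    using subset_Zorn_nonempty[of \<A>] by blast
  have "x = \<zero>" if x: "x \<in> V" and orth: "\<forall>b\<in>B. ip x b = 0" for x
  proof (rule ccontr)
    assume "x \<noteq> \<zero>"
    have xc: "x \<in> carrier H" using x V by auto
    then have pos: "hnorm H x \<noteq> 0" using \<open>x \<noteq> \<zero>\<close> hnorm_eq_zero by simp
    define u where "u = complex_of_real (inverse (hnorm H x)) \<odot> x"
    have u: "u \<in> V" "u \<in> carrier H" using smult[OF x] xc by (simp_all add: u_def)
    have "ip u u = 1"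
      using xc pos inner_self[OF xc] unfolding u_def
      by (simp add: inner_smult_left inner_smult_right power2_eq_square field_simps)
    moreover have *: "ip u b = 0" "ip b u = 0" if "b \<in> B" for b
    proof -
      have b: "b \<in> carrier H" using that B by (auto simp: \<A>_def orthonormal_def)
      show "ip u b = 0" using orth that xc b by (simp add: u_def inner_smult_left)
      then show "ip b u = 0" using inner_commute[OF b u(2)] by simp
    qed
    ultimately have "u \<notin> B" by force
    moreover have "insert u B \<in> \<A>"
      using B u * \<open>ip u u = 1\<close> by (auto simp: \<A>_def orthonormal_def)
    ultimately show False using maximal[of "insert u B"] by blast
  qed
  then show ?thesis using B by (auto simp: \<A>_def orthonormal_basis_of_def)
qed

text \<open>
  Different members of an orthonormal set are too far apart to be approximated by the same vector.
\<close>

lemma orthonormal_countable: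
  assumes "separable H" "orthonormal H B"
  shows "countable B"
proof -
  obtain D where D: "D \<subseteq> carrier H" "countable D"
    and dense: "\<And>x \<epsilon>. \<lbrakk>x \<in> carrier H; \<epsilon> > 0\<rbrakk> \<Longrightarrow> \<exists>d\<in>D. hnorm H (x \<ominus> d) < \<epsilon>"
    using assms(1) unfolding separable_def by metis
  have B: "\<And>b. b \<in> B \<Longrightarrow> b \<in> carrier H"
    and ip_B: "\<And>b c. \<lbrakk>b \<in> B; c \<in> B\<rbrakk> \<Longrightarrow> ip b c = (if b = c then 1 else 0)"
    using assms(2) by (auto simp: orthonormal_def)
  have "\<forall>b\<in>B. \<exists>d\<in>D. hnorm H (b \<ominus> d) < 1 / 2"
    by (intro ballI dense B) simp_all
  then obtain d where d: "\<And>b. b \<in> B \<Longrightarrow> d b \<in> D" "\<And>b. b \<in> B \<Longrightarrow> hnorm H (b \<ominus> d b) < 1 / 2"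
    by metis
  have near: "cmod (ip b c - ip (d b) c) < 1 / 2" if "b \<in> B" "c \<in> B" for b c
  proof -
    have car: "b \<in> carrier H" "c \<in> carrier H" "d b \<in> carrier H" using that B d D by auto
    have "hnorm H c = 1" using ip_B[OF that(2) that(2)] by (simp add: hnorm_def)
    then show ?thesis
      using Cauchy_Schwarz[of "b \<ominus> d b" c] car d(2)[OF that(1)] by (simp add: inner_diff_left)
  qed
  have "inj_on d B"
  proof (rule inj_onI, rule ccontr)
    fix b c assume bc: "b \<in> B" "c \<in> B" "d b = d c" "b \<noteq> c"
    \<comment> \<open>the coordinate of \<open>d b\<close> along \<open>b\<close> is within 1/2 of both 1 and 0\<close>
    have "cmod (1 - ip (d b) b) < 1 / 2" "cmod (ip (d b) b) < 1 / 2"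
      using near[of b b] near[of c b] bc ip_B by simp_all
    moreover have "(1::real) \<le> cmod (1 - ip (d b) b) + cmod (ip (d b) b)"
      by (metis diff_add_cancel norm_one norm_triangle_ineq)
    ultimately show False by simp
  qed
  moreover have "countable (d ` B)"
    using d(1) D(2) by (meson countable_subset image_subsetI)
  ultimately show ?thesis by (simp add: countable_image_inj_eq)
qed


section \<open>Coordinates with respect to an orthonormal set\<close>

definition combination :: "('h \<Rightarrow> complex) \<Rightarrow> 'h set \<Rightarrow> 'h" where
  "combination c F = (\<Oplus>b\<in>F. c b \<odot> b)"

lemma combination_closed: "F \<subseteq> carrier H \<Longrightarrow> combination c F \<in> carrier H"
  unfolding combination_def by (intro finsum_closed) auto

lemma inner_combination_left:
  assumes "finite F" "F \<subseteq> carrier H" "y \<in> carrier H"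
  shows "ip (combination c F) y = (\<Sum>b\<in>F. c b * ip b y)"
proof -
  have "ip (combination c F) y = (\<Sum>b\<in>F. ip (c b \<odot> b) y)"
    unfolding combination_def using assms by (intro inner_finsum_left) auto
  also have "\<dots> = (\<Sum>b\<in>F. c b * ip b y)"
    using assms by (intro sum.cong) (auto simp: inner_smult_left)
  finally show ?thesis .
qed

lemma inner_combination_basis:
  assumes "orthonormal H B" "finite F" "F \<subseteq> B" "b \<in> B"
  shows "ip (combination c F) b = (if b \<in> F then c b else 0)"
proof -
  have "ip (combination c F) b = (\<Sum>a\<in>F. c a * ip a b)"
    using assms by (intro inner_combination_left) (auto simp: orthonormal_def)
  also have "\<dots> = (\<Sum>a\<in>F. if a = b then c a else 0)"
    using assms by (intro sum.cong) (auto simp: orthonormal_def subset_iff)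
  finally show ?thesis using assms by simp
qed

lemma inner_combinations:
  assumes B: "orthonormal H B" and F: "finite F" "F \<subseteq> B" and G: "finite G" "G \<subseteq> B"
  shows "ip (combination c F) (combination d G) = (\<Sum>b\<in>F \<inter> G. c b * cnj (d b))"
proof -
  have car: "F \<subseteq> carrier H" "G \<subseteq> carrier H" using assms by (auto simp: orthonormal_def)
  have "ip (combination c F) (combination d G) = (\<Sum>b\<in>F. c b * ip b (combination d G))"
    using F car by (intro inner_combination_left combination_closed) auto
  also have "\<dots> = (\<Sum>b\<in>F. if b \<in> G then c b * cnj (d b) else 0)"
  proof (intro sum.cong refl)
    fix b assume "b \<in> F"
    then have "b \<in> B" "b \<in> carrier H" using F car by auto
    then have "ip b (combination d G) = cnj (if b \<in> G then d b else 0)"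
      using inner_commute[OF _ combination_closed[OF car(2)], of b d]
      by (simp add: inner_combination_basis[OF B G])
    then show "c b * ip b (combination d G) = (if b \<in> G then c b * cnj (d b) else 0)" by simp
  qed
  finally show ?thesis using F by (simp add: sum.inter_restrict)
qed

lemma bessel:
  assumes B: "orthonormal H B" and F: "finite F" "F \<subseteq> B" and x: "x \<in> carrier H"
  shows "(\<Sum>b\<in>F. (cmod (ip x b))\<^sup>2) \<le> (hnorm H x)\<^sup>2"
proof -
  define y where "y = combination (ip x) F"
  define s where "s = (\<Sum>b\<in>F. (cmod (ip x b))\<^sup>2)"
  have car: "F \<subseteq> carrier H" using assms by (auto simp: orthonormal_def)
  then have y: "y \<in> carrier H" unfolding y_def by (rule combination_closed)
  have "ip y y = s"
    using inner_combinations[OF B F F]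
    by (simp add: y_def s_def complex_norm_square del: of_real_power)
  moreover have yx: "ip y x = s"
  proof -
    have "ip y x = (\<Sum>b\<in>F. ip x b * ip b x)"
      unfolding y_def using F car x by (intro inner_combination_left) auto
    also have "\<dots> = (\<Sum>b\<in>F. complex_of_real ((cmod (ip x b))\<^sup>2))"
      using car x by (intro sum.cong refl) (metis complex_norm_square inner_commute subsetD)
    finally show ?thesis by (simp add: s_def)
  qed
  moreover have "ip x y = s" using inner_commute[OF x y] yx by simp
  ultimately have "ip (x \<ominus> y) (x \<ominus> y) = complex_of_real ((hnorm H x)\<^sup>2 - s)"
    using x y by (simp add: inner_diff_left inner_diff_right inner_self[OF x])
  then show ?thesis
    using inner_nonneg[of "x \<ominus> y"] x y by (simp add: s_def)
qed

lemma coordinates_summable: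
  assumes "orthonormal H B" "x \<in> carrier H"
  shows "(\<lambda>b. (cmod (ip x b))\<^sup>2) summable_on B"
  using bessel[OF assms(1) _ _ assms(2)]
  by (intro nonneg_bdd_above_summable_on bdd_aboveI[of _ "(hnorm H x)\<^sup>2"]) auto

end

lemma summable_on_mult_cnj:
  fixes f g :: "'x \<Rightarrow> complex"
  assumes "(\<lambda>b. (cmod (f b))\<^sup>2) summable_on B" "(\<lambda>b. (cmod (g b))\<^sup>2) summable_on B"
  shows "(\<lambda>b. norm (f b * cnj (g b))) summable_on B"
proof (rule summable_on_comparison_test)
  show "(\<lambda>b. (cmod (f b))\<^sup>2 + (cmod (g b))\<^sup>2) summable_on B"
    using assms by (rule summable_on_add)
  show "norm (f b * cnj (g b)) \<le> (cmod (f b))\<^sup>2 + (cmod (g b))\<^sup>2" for b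
    using sum_squares_bound[of "cmod (f b)" "cmod (g b)"]
      mult_nonneg_nonneg[OF norm_ge_zero[of "f b"] norm_ge_zero[of "g b"]]
    unfolding norm_mult complex_mod_cnj by linarith
qed simp

text \<open>An exhaustion of a countable set by finite sets, so that sums over it become limits of sequences.\<close>

definition initial_part :: "'a set \<Rightarrow> nat \<Rightarrow> 'a set" where
  "initial_part B n = {b \<in> B. to_nat_on B b < n}"

lemma initial_part_subset: "initial_part B n \<subseteq> B"
  by (auto simp: initial_part_def)

lemma initial_part_mono: "m \<le> n \<Longrightarrow> initial_part B m \<subseteq> initial_part B n"
  by (auto simp: initial_part_def)

lemma initial_part_Int: "initial_part B m \<inter> initial_part B n = initial_part B (min m n)"
  by (auto simp: initial_part_def)

lemma finite_initial_part:
  assumes "countable B"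
  shows "finite (initial_part B n)"
proof (rule inj_on_finite)
  show "inj_on (to_nat_on B) (initial_part B n)"
    using inj_on_to_nat_on[OF assms] initial_part_subset by (rule inj_on_subset)
  show "to_nat_on B ` initial_part B n \<subseteq> {..<n}" by (auto simp: initial_part_def)
qed simp

lemma filterlim_initial_part:
  assumes "countable B"
  shows "filterlim (initial_part B) (finite_subsets_at_top B) sequentially"
  unfolding filterlim_iff eventually_finite_subsets_at_top
proof (intro allI impI)
  fix Q assume "\<exists>X. finite X \<and> X \<subseteq> B \<and> (\<forall>Y. finite Y \<and> X \<subseteq> Y \<and> Y \<subseteq> B \<longrightarrow> Q Y)"
  then obtain X where X: "finite X" "X \<subseteq> B"
    and Q: "\<forall>Y. finite Y \<and> X \<subseteq> Y \<and> Y \<subseteq> B \<longrightarrow> Q Y"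
    by (elim exE conjE)
  have "Q (initial_part B n)" if n: "Suc (Max (insert 0 (to_nat_on B ` X))) \<le> n" for n
  proof -
    have "b \<in> initial_part B n" if "b \<in> X" for b
    proof -
      have "to_nat_on B b \<le> Max (insert 0 (to_nat_on B ` X))"
        using X(1) that by (intro Max_ge) auto
      then show ?thesis using n X(2) that by (auto simp: initial_part_def)
    qed
    then have "X \<subseteq> initial_part B n" by (rule subsetI)
    then show ?thesis
      using Q[rule_format, of "initial_part B n"] finite_initial_part[OF assms, of n]
        initial_part_subset[of B n] by simp
  qed
  then show "\<forall>\<^sub>F n in sequentially. Q (initial_part B n)"
    unfolding eventually_sequentially by blast
qed

lemma has_sum_initial_part:
  assumes "countable B" "(f has_sum s) B"
  shows "(\<lambda>n. \<Sum>b\<in>initial_part B n. f b) \<longlonglongrightarrow> s"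
  using filterlim_compose[OF assms(2)[unfolded has_sum_def] filterlim_initial_part[OF assms(1)]]
  by simp

context hilbert_space
begin

text \<open>
  The partial sums of \<open>\<Sum> c b \<odot> b\<close> have square distance \<open>\<bar>s m - s n\<bar>\<close>, where \<open>s n\<close> are the partial sums of
  \<open>\<Sum> \<bar>c b\<bar>\<^sup>2\<close>, so they form a Cauchy sequence.
\<close>

lemma riesz_fischer:
  assumes B: "orthonormal H B" and cnt: "countable B"
    and c: "(\<lambda>b. (cmod (c b))\<^sup>2) summable_on B"
  shows "\<exists>y\<in>carrier H. norm_limit H (hnorm H) (\<lambda>n. combination c (initial_part B n)) y \<and>
    (\<forall>b\<in>B. ip y b = c b)"
proof -
  define F where "F = initial_part B"
  define \<sigma> where "\<sigma> = (\<lambda>n. combination c (F n))"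
  define s where "s n = (\<Sum>b\<in>F n. (cmod (c b))\<^sup>2)" for n
  have F: "finite (F n)" "F n \<subseteq> B" for n
    using cnt by (simp_all add: F_def finite_initial_part initial_part_subset)
  have B_carrier: "B \<subseteq> carrier H" using B by (simp add: orthonormal_def)
  have \<sigma>: "\<sigma> n \<in> carrier H" for n
    unfolding \<sigma>_def using F B_carrier by (intro combination_closed) auto
  have ip_\<sigma>: "ip (\<sigma> m) (\<sigma> n) = s (min m n)" for m n
  proof -
    have "ip (\<sigma> m) (\<sigma> n) = (\<Sum>b\<in>F m \<inter> F n. c b * cnj (c b))"
      unfolding \<sigma>_def by (rule inner_combinations[OF B F F])
    also have "F m \<inter> F n = F (min m n)" unfolding F_def by (rule initial_part_Int)
    finally show ?thesis by (simp add: s_def complex_norm_square del: of_real_power)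
  qed
  have dist: "(hnorm H (\<sigma> m \<ominus> \<sigma> n))\<^sup>2 = \<bar>s m - s n\<bar>" for m n
  proof -
    have "ip (\<sigma> m \<ominus> \<sigma> n) (\<sigma> m \<ominus> \<sigma> n) = complex_of_real (s m + s n - 2 * s (min m n))"
      using \<sigma> by (simp add: inner_diff_left inner_diff_right ip_\<sigma> min.commute)
    then have *: "(hnorm H (\<sigma> m \<ominus> \<sigma> n))\<^sup>2 = s m + s n - 2 * s (min m n)"
      unfolding inner_self[OF minus_closed[OF \<sigma> \<sigma>]] of_real_eq_iff .
    have mono: "s i \<le> s j" if "i \<le> j" for i j
      unfolding s_def F_def
      by (intro sum_mono2 initial_part_mono finite_initial_part cnt that) simp
    show ?thesis
      using * mono[of m n] mono[of n m] by (cases "m \<le> n") (simp_all add: min_def)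
  qed
  have "(\<lambda>n. s n) \<longlonglongrightarrow> (\<Sum>\<^sub>\<infinity>b\<in>B. (cmod (c b))\<^sup>2)"
    unfolding s_def F_def by (intro has_sum_initial_part[OF cnt] has_sum_infsum c)
  then have "Cauchy s" by (rule LIMSEQ_imp_Cauchy)
  have "\<exists>N. \<forall>m\<ge>N. \<forall>n\<ge>N. hnorm H (\<sigma> m \<ominus> \<sigma> n) < \<epsilon>" if "\<epsilon> > 0" for \<epsilon>
  proof -
    obtain N where N: "\<And>m n. \<lbrakk>m \<ge> N; n \<ge> N\<rbrakk> \<Longrightarrow> \<bar>s m - s n\<bar> < \<epsilon>\<^sup>2"
      using metric_CauchyD[OF \<open>Cauchy s\<close>, of "\<epsilon>\<^sup>2"] \<open>\<epsilon> > 0\<close> by (auto simp: dist_real_def)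
    have "hnorm H (\<sigma> m \<ominus> \<sigma> n) < \<epsilon>" if "m \<ge> N" "n \<ge> N" for m n
      by (rule power2_less_imp_less) (use N[OF that] \<open>\<epsilon> > 0\<close> dist[of m n] in simp_all)
    then show ?thesis by blast
  qed
  then obtain y where y: "y \<in> carrier H" and lim: "norm_limit H (hnorm H) \<sigma> y"
    using complete[unfolded norm_complete_def, THEN spec[of _ \<sigma>]] \<sigma> by auto
  have "ip y b = c b" if b: "b \<in> B" for b
  proof (rule LIMSEQ_unique)
    show "(\<lambda>n. ip (\<sigma> n) b) \<longlonglongrightarrow> ip y b"
      using tendsto_inner_left[OF \<sigma> lim y] b B_carrier by auto
    have "\<forall>\<^sub>F n in sequentially. ip (\<sigma> n) b = c b"
      unfolding eventually_sequentially
    proof (intro exI allI impI)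
      fix n assume "Suc (to_nat_on B b) \<le> n"
      then have "b \<in> F n" using b by (simp add: F_def initial_part_def)
      then show "ip (\<sigma> n) b = c b"
        unfolding \<sigma>_def using inner_combination_basis[OF B F b] by simp
    qed
    then show "(\<lambda>n. ip (\<sigma> n) b) \<longlonglongrightarrow> c b" by (rule tendsto_eventually)
  qed
  then show ?thesis using y lim[unfolded \<sigma>_def F_def] by blast
qed

lemma coordinates_eqD:
  assumes "orthonormal_basis_of H (carrier H) B" "x \<in> carrier H" "y \<in> carrier H"
    "\<And>b. b \<in> B \<Longrightarrow> ip x b = ip y b"
  shows "x = y"
proof (rule diff_eq_zero_imp_eq)
  have "ip (x \<ominus> y) b = 0" if "b \<in> B" for b
    using assms that by (subst inner_diff_left) (auto simp: orthonormal_basis_of_def)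
  then show "x \<ominus> y = \<zero>"
    using assms by (auto simp: orthonormal_basis_of_def)
qed (use assms in auto)

text \<open>
  The vector that has the coordinates of \<open>x\<close> and is a limit of finite combinations of the basis must be
  \<open>x\<close> itself, so inner products with \<open>x\<close> are limits of finite sums.
\<close>

lemma parseval:
  assumes basis: "orthonormal_basis_of H (carrier H) B" and cnt: "countable B"
    and x: "x \<in> carrier H" and y: "y \<in> carrier H"
  shows "(\<Sum>\<^sub>\<infinity>b\<in>B. ip x b * cnj (ip y b)) = ip x y"
proof -
  have B: "orthonormal H B" "B \<subseteq> carrier H"
    using basis by (simp_all add: orthonormal_basis_of_def)
  obtain x' where x': "x' \<in> carrier H"
    and lim: "norm_limit H (hnorm H) (\<lambda>n. combination (ip x) (initial_part B n)) x'"
    and eq: "\<forall>b\<in>B. ip x' b = ip x b"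
    using riesz_fischer[OF B(1) cnt coordinates_summable[OF B(1) x]] by (elim bexE conjE)
  have "x' = x" by (rule coordinates_eqD[OF basis x' x]) (rule bspec[OF eq])
  have car: "initial_part B n \<subseteq> carrier H" for n
    using initial_part_subset B(2) by (rule order_trans)
  have "(\<lambda>n. ip (combination (ip x) (initial_part B n)) y) \<longlonglongrightarrow> ip x y"
    using lim combination_closed[OF car] x y unfolding \<open>x' = x\<close> by (intro tendsto_inner_left)
  moreover have "ip (combination (ip x) (initial_part B n)) y
      = (\<Sum>b\<in>initial_part B n. ip x b * cnj (ip y b))" for n
  proof -
    have "ip (combination (ip x) (initial_part B n)) y = (\<Sum>b\<in>initial_part B n. ip x b * ip b y)"
      using finite_initial_part[OF cnt] car y by (rule inner_combination_left)
    also have "\<dots> = (\<Sum>b\<in>initial_part B n. ip x b * cnj (ip y b))"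
      using car y by (intro sum.cong refl) (metis inner_commute subsetD)
    finally show ?thesis .
  qed
  ultimately have "(\<lambda>n. \<Sum>b\<in>initial_part B n. ip x b * cnj (ip y b)) \<longlonglongrightarrow> ip x y" by simp
  moreover have "(\<lambda>b. ip x b * cnj (ip y b)) summable_on B"
    by (rule abs_summable_summable[OF summable_on_mult_cnj[OF
          coordinates_summable[OF B(1) x] coordinates_summable[OF B(1) y]]])
  then have "(\<lambda>n. \<Sum>b\<in>initial_part B n. ip x b * cnj (ip y b))
      \<longlonglongrightarrow> (\<Sum>\<^sub>\<infinity>b\<in>B. ip x b * cnj (ip y b))"
    by (intro has_sum_initial_part[OF cnt] has_sum_infsum)
  ultimately show ?thesis by (intro LIMSEQ_unique)
qed

end


section \<open>Square-summable functions\<close>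

lemma square_integrable_count_space:
  "\<phi> \<in> square_integrable (count_space I) \<longleftrightarrow> (\<lambda>x. (cmod (\<phi> x))\<^sup>2) summable_on I"
  using abs_summable_equivalent[of "\<lambda>x. (cmod (\<phi> x))\<^sup>2" I]
  by (simp add: square_integrable_def abs_summable_on_def)

lemma l2_class_count_space:
  "l2_class (count_space I) \<phi> =
     {\<psi>. (\<lambda>x. (cmod (\<psi> x))\<^sup>2) summable_on I \<and> (\<forall>x\<in>I. \<psi> x = \<phi> x)}"
  by (auto simp: l2_class_def square_integrable_count_space AE_count_space)

lemma l2_class_count_space_cong:
  "(\<And>x. x \<in> I \<Longrightarrow> \<phi> x = \<psi> x) \<Longrightarrow> l2_class (count_space I) \<phi> = l2_class (count_space I) \<psi>"
  by (simp add: l2_class_count_space)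

lemma l2_rep_count_space:
  assumes "\<phi> \<in> square_integrable (count_space I)" "x \<in> I"
  shows "l2_rep (l2_class (count_space I) \<phi>) x = \<phi> x"
proof -
  have "\<phi> \<in> l2_class (count_space I) \<phi>"
    using assms(1) by (simp add: l2_class_count_space square_integrable_count_space)
  then have "l2_rep (l2_class (count_space I) \<phi>) \<in> l2_class (count_space I) \<phi>"
    unfolding l2_rep_def by (rule someI[where P = "\<lambda>\<psi>. \<psi> \<in> l2_class (count_space I) \<phi>"])
  then show ?thesis using assms(2) by (simp add: l2_class_count_space)
qed

text \<open>
  The injection \<open>g\<close> serves to index the basis by points of a prescribed type.
\<close>

definition coordinate_map ::
  "('h, 'm) inner_space_scheme \<Rightarrow> 'h set \<Rightarrow> ('h \<Rightarrow> 'x) \<Rightarrow> 'h \<Rightarrow> ('x \<Rightarrow> complex) set" where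
  "coordinate_map H B g x =
     l2_class (count_space (g ` B)) (\<lambda>r. inner_prod H x (inv_into B g r))"

context hilbert_space
begin

lemma coordinates_square_integrable:
  assumes "orthonormal H B" "inj_on g B" "x \<in> carrier H"
  shows "(\<lambda>r. ip x (inv_into B g r)) \<in> square_integrable (count_space (g ` B))"
  unfolding square_integrable_count_space
  using summable_on_reindex_bij_betw[OF bij_betw_inv_into[OF inj_on_imp_bij_betw[OF assms(2)]],
      of "\<lambda>b. (cmod (ip x b))\<^sup>2"] coordinates_summable[OF assms(1,3)] by simp

lemma coordinate_map_unitary:
  assumes basis: "orthonormal_basis_of H (carrier H) B" and cnt: "countable B" and inj: "inj_on g B"
  shows "unitary_map H (l2_space (count_space (g ` B))) (coordinate_map H B g)"
proof -
  define I where "I = g ` B"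
  define h where "h = inv_into B g"
  define U where "U = coordinate_map H B g"
  have B: "orthonormal H B" and B_carrier: "B \<subseteq> carrier H"
    using basis by (simp_all add: orthonormal_basis_of_def)
  have h: "bij_betw h I B"
    unfolding h_def I_def by (rule bij_betw_inv_into[OF inj_on_imp_bij_betw[OF inj]])
  have h_closed: "h r \<in> carrier H" if "r \<in> I" for r
    using h B_carrier that by (auto simp: bij_betw_def)
  have U: "U x = l2_class (count_space I) (\<lambda>r. ip x (h r))" for x
    by (simp add: U_def coordinate_map_def I_def h_def)
  have sq: "(\<lambda>r. ip x (h r)) \<in> square_integrable (count_space I)" if "x \<in> carrier H" for x
    unfolding I_def h_def using B inj that by (rule coordinates_square_integrable)
  have rep: "l2_rep (U x) r = ip x (h r)" if "x \<in> carrier H" "r \<in> I" for x r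
    unfolding U using sq[OF that(1)] that(2) by (rule l2_rep_count_space)
  have "linear_map H (l2_space (count_space I)) U"
    unfolding linear_map_def
  proof (intro conjI ballI allI)
    show "U \<in> carrier H \<rightarrow> carrier (l2_space (count_space I))"
      using sq by (auto simp: l2_space_def U)
    show "U (x \<oplus> y) = U x \<oplus>\<^bsub>l2_space (count_space I)\<^esub> U y"
      if "x \<in> carrier H" "y \<in> carrier H" for x y
      unfolding U[of "x \<oplus> y"] using that h_closed
      by (auto simp: l2_space_def rep inner_add_left intro!: l2_class_count_space_cong)
    show "U (c \<odot> x) = c \<odot>\<^bsub>l2_space (count_space I)\<^esub> U x" if "x \<in> carrier H" for c x
      unfolding U[of "c \<odot> x"] using that h_closed
      by (auto simp: l2_space_def rep inner_smult_left intro!: l2_class_count_space_cong)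
  qed
  moreover have "bij_betw U (carrier H) (carrier (l2_space (count_space I)))"
    unfolding bij_betw_def
  proof
    show "inj_on U (carrier H)"
    proof (rule inj_onI)
      fix x y assume xy: "x \<in> carrier H" "y \<in> carrier H" "U x = U y"
      show "x = y"
      proof (rule coordinates_eqD[OF basis xy(1,2)])
        fix b assume "b \<in> B"
        then obtain r where "r \<in> I" "b = h r" using h by (auto simp: bij_betw_def)
        then show "ip x b = ip y b" using rep[of x r] rep[of y r] xy by simp
      qed
    qed
    show "U ` carrier H = carrier (l2_space (count_space I))"
    proof
      show "U ` carrier H \<subseteq> carrier (l2_space (count_space I))"
        using sq by (auto simp: l2_space_def U)
      show "carrier (l2_space (count_space I)) \<subseteq> U ` carrier H"
      proof
        fix F assume "F \<in> carrier (l2_space (count_space I))"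
        then obtain \<phi> where \<phi>: "\<phi> \<in> square_integrable (count_space I)"
          and F: "F = l2_class (count_space I) \<phi>" by (auto simp: l2_space_def)
        have "(\<lambda>b. (cmod (\<phi> (g b)))\<^sup>2) summable_on B"
          using \<phi> summable_on_reindex[OF inj, of "\<lambda>r. (cmod (\<phi> r))\<^sup>2"]
          by (simp add: square_integrable_count_space I_def o_def)
        then obtain y where y: "y \<in> carrier H" "\<forall>b\<in>B. ip y b = \<phi> (g b)"
          using riesz_fischer[OF B cnt, of "\<lambda>b. \<phi> (g b)"] by blast
        have "ip y (h r) = \<phi> r" if "r \<in> I" for r
          using y(2) that f_inv_into_f[of r g B] inv_into_into[of r g B]
          by (simp add: h_def I_def)
        then have "U y = F" unfolding U F by (rule l2_class_count_space_cong)
        then show "F \<in> U ` carrier H" using y(1) by blast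
      qed
    qed
  qed
  moreover have "inner_prod (l2_space (count_space I)) (U x) (U y) = ip x y"
    if xy: "x \<in> carrier H" "y \<in> carrier H" for x y
  proof -
    have "inner_prod (l2_space (count_space I)) (U x) (U y)
        = (\<integral>r. ip x (h r) * cnj (ip y (h r)) \<partial>count_space I)"
      using rep xy by (auto simp: l2_space_def intro!: Bochner_Integration.integral_cong)
    also have "\<dots> = infsetsum (\<lambda>r. ip x (h r) * cnj (ip y (h r))) I"
      by (simp add: infsetsum_def)
    also have "\<dots> = (\<Sum>\<^sub>\<infinity>r\<in>I. ip x (h r) * cnj (ip y (h r)))"
      using summable_on_mult_cnj[OF sq[OF xy(1), unfolded square_integrable_count_space]
          sq[OF xy(2), unfolded square_integrable_count_space]]
      unfolding abs_summable_equivalent by (rule infsetsum_infsum)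
    also have "\<dots> = (\<Sum>\<^sub>\<infinity>b\<in>B. ip x b * cnj (ip y b))"
      by (rule infsum_reindex_bij_betw[OF h])
    also have "\<dots> = ip x y" using basis cnt xy by (rule parseval)
    finally show ?thesis .
  qed
  ultimately show ?thesis unfolding unitary_map_def U_def I_def by blast
qed

end


section \<open>Transport of a representation along a unitary map\<close>

definition transported_representation ::
  "('h, 'n) inner_space_scheme \<Rightarrow> ('h \<Rightarrow> 'k) \<Rightarrow> ('a \<Rightarrow> 'h \<Rightarrow> 'h) \<Rightarrow> 'a \<Rightarrow> 'k \<Rightarrow> 'k" where
  "transported_representation H U \<pi> a y = U (\<pi> a (inv_into (carrier H) U y))"

lemma transported_representation_apply:
  assumes "unitary_map H K U" "x \<in> carrier H"
  shows "transported_representation H U \<pi> a (U x) = U (\<pi> a x)"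
  using assms by (simp add: transported_representation_def unitary_map_def bij_betw_def)

text \<open>
  Transport turns the search for an induced representation into a search for a unitary map under which
  the generators take the form given by a branching system: the transported map is a representation by
  itself, so only its values at the generators have to be computed.
\<close>

lemma cstar_representation_transport:
  assumes H: "hilbert_space H" and U: "unitary_map H K U" and \<pi>: "cstar_representation A H \<pi>"
    and star: "\<And>a. a \<in> carrier A \<Longrightarrow> star A a \<in> carrier A"
  shows "cstar_representation A K (transported_representation H U \<pi>)"
proof -
  interpret hilbert_space H by (rule H)
  define \<rho> where "\<rho> = transported_representation H U \<pi>"
  have \<rho>: "\<rho> a (U x) = U (\<pi> a x)" if "x \<in> carrier H" for a x
    unfolding \<rho>_def by (rule transported_representation_apply[OF U that])
  have surj: "\<exists>x\<in>carrier H. y = U x" if "y \<in> carrier K" for y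
    using U that by (auto simp: unitary_map_def bij_betw_def)
  have U_closed: "U x \<in> carrier K" if "x \<in> carrier H" for x
    using U that by (auto simp: unitary_map_def bij_betw_def)
  have U_add: "U (x \<oplus>\<^bsub>H\<^esub> y) = U x \<oplus>\<^bsub>K\<^esub> U y" if "x \<in> carrier H" "y \<in> carrier H" for x y
    using U that by (simp add: unitary_map_def linear_map_def)
  have U_smult: "U (c \<odot>\<^bsub>H\<^esub> x) = c \<odot>\<^bsub>K\<^esub> U x" if "x \<in> carrier H" for c x
    using U that by (simp add: unitary_map_def linear_map_def)
  have U_inner: "inner_prod K (U x) (U y) = inner_prod H x y"
    if "x \<in> carrier H" "y \<in> carrier H" for x y
    using U that by (simp add: unitary_map_def)
  have U_norm: "hnorm K (U x) = hnorm H x" if "x \<in> carrier H" for x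
    using U_inner that by (simp add: hnorm_def)
  have \<pi>_lin: "\<pi> a x \<in> carrier H" "\<pi> a (x \<oplus>\<^bsub>H\<^esub> y) = \<pi> a x \<oplus>\<^bsub>H\<^esub> \<pi> a y" "\<pi> a (c \<odot>\<^bsub>H\<^esub> x) = c \<odot>\<^bsub>H\<^esub> \<pi> a x"
    if "a \<in> carrier A" "x \<in> carrier H" "y \<in> carrier H" for a x y c
    using \<pi> that by (auto simp: cstar_representation_def bounded_operator_def linear_map_def)
  have "bounded_operator K (\<rho> a)" if a: "a \<in> carrier A" for a
  proof -
    obtain C where C: "\<forall>x\<in>carrier H. hnorm H (\<pi> a x) \<le> C * hnorm H x"
      using \<pi> a by (auto simp: cstar_representation_def bounded_operator_def)
    have "linear_map K K (\<rho> a)"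
      unfolding linear_map_def
    proof (intro conjI ballI allI)
      show "\<rho> a \<in> carrier K \<rightarrow> carrier K"
      proof
        fix y assume "y \<in> carrier K"
        then obtain x where "x \<in> carrier H" "y = U x" using surj by blast
        then show "\<rho> a y \<in> carrier K" using \<pi>_lin(1)[OF a] U_closed by (simp add: \<rho>)
      qed
      show "\<rho> a (y \<oplus>\<^bsub>K\<^esub> y') = \<rho> a y \<oplus>\<^bsub>K\<^esub> \<rho> a y'" if y: "y \<in> carrier K" "y' \<in> carrier K" for y y'
      proof -
        obtain x x' where x: "x \<in> carrier H" "x' \<in> carrier H" "y = U x" "y' = U x'"
          using surj y by blast
        show ?thesis
          unfolding x(3,4) using x(1,2) \<pi>_lin[OF a] by (simp add: U_add[symmetric] \<rho>)
      qed
      show "\<rho> a (c \<odot>\<^bsub>K\<^esub> y) = c \<odot>\<^bsub>K\<^esub> \<rho> a y" if y: "y \<in> carrier K" for c y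
      proof -
        obtain x where x: "x \<in> carrier H" "y = U x" using surj y by blast
        show ?thesis
          unfolding x(2) using x(1) \<pi>_lin[OF a] by (simp add: U_smult[symmetric] \<rho>)
      qed
    qed
    moreover have "hnorm K (\<rho> a y) \<le> C * hnorm K y" if "y \<in> carrier K" for y
      using surj[OF that] C \<pi>_lin(1)[OF a] by (auto simp: \<rho> U_norm)
    ultimately show ?thesis unfolding bounded_operator_def by blast
  qed
  moreover have "\<rho> (a \<oplus>\<^bsub>A\<^esub> b) y = \<rho> a y \<oplus>\<^bsub>K\<^esub> \<rho> b y" "\<rho> (c \<odot>\<^bsub>A\<^esub> a) y = c \<odot>\<^bsub>K\<^esub> \<rho> a y"
    "\<rho> (a \<otimes>\<^bsub>A\<^esub> b) y = \<rho> a (\<rho> b y)"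
    if ab: "a \<in> carrier A" "b \<in> carrier A" and "y \<in> carrier K" for a b c y
  proof -
    obtain x where x: "x \<in> carrier H" "y = U x" using surj \<open>y \<in> carrier K\<close> by blast
    show "\<rho> (a \<oplus>\<^bsub>A\<^esub> b) y = \<rho> a y \<oplus>\<^bsub>K\<^esub> \<rho> b y" "\<rho> (c \<odot>\<^bsub>A\<^esub> a) y = c \<odot>\<^bsub>K\<^esub> \<rho> a y"
      "\<rho> (a \<otimes>\<^bsub>A\<^esub> b) y = \<rho> a (\<rho> b y)"
      unfolding x(2) using \<pi> ab x(1) \<pi>_lin(1)[OF _ x(1)]
      by (simp_all add: \<rho> U_add[symmetric] U_smult[symmetric] cstar_representation_def)
  qed
  moreover have "inner_prod K (\<rho> a y) z = inner_prod K y (\<rho> (star A a) z)"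
    if a: "a \<in> carrier A" and yz: "y \<in> carrier K" "z \<in> carrier K" for a y z
  proof -
    obtain x w where x: "x \<in> carrier H" "w \<in> carrier H" "y = U x" "z = U w"
      using surj yz by blast
    show ?thesis
      unfolding x(3,4) using \<pi> a star[OF a] x(1,2) \<pi>_lin(1)
      by (simp add: \<rho> U_inner cstar_representation_def)
  qed
  ultimately show ?thesis
    unfolding cstar_representation_def \<rho>_def[symmetric] by (intro conjI ballI allI)
qed


section \<open>A graph algebra acting on a Hilbert space\<close>

locale graph_representation = hilbert_space H
  for H :: "('h, 'n) inner_space_scheme" (structure) +
  fixes E :: "('v, 'e) pre_digraph" and A :: "('a, 'm) star_algebra_scheme"
    and P :: "'v \<Rightarrow> 'a" and S :: "'e \<Rightarrow> 'a" and \<pi> :: "'a \<Rightarrow> 'h \<Rightarrow> 'h"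
  assumes digraph: "wf_digraph E"
    and algebra: "cstar_algebra A"
    and family: "graph_family E A P S"
    and representation: "cstar_representation A H \<pi>"
begin

abbreviation vproj where "vproj v \<equiv> \<pi> (P v)"
abbreviation edge where "edge e \<equiv> \<pi> (S e)"
abbreviation coedge where "coedge e \<equiv> \<pi> (star A (S e))"

lemma head_vert [simp]: "e \<in> arcs E \<Longrightarrow> head E e \<in> verts E"
  and tail_vert [simp]: "e \<in> arcs E \<Longrightarrow> tail E e \<in> verts E"
  using digraph by (simp_all add: wf_digraph_def)

lemma star_in_A: "a \<in> carrier A \<Longrightarrow> star A a \<in> carrier A"
  using cstar_algebra.star_closed[OF algebra] .

lemma mult_in_A: "a \<in> carrier A \<Longrightarrow> b \<in> carrier A \<Longrightarrow> a \<otimes>\<^bsub>A\<^esub> b \<in> carrier A"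
  using cstar_algebra.mult_closed[OF algebra] .

lemma P_in_A: "v \<in> verts E \<Longrightarrow> P v \<in> carrier A"
  using family by (simp add: graph_family_def is_projection_def)

lemma S_in_A: "e \<in> arcs E \<Longrightarrow> S e \<in> carrier A"
  using family by (simp add: graph_family_def is_partial_isometry_def)

lemmas in_A = star_in_A mult_in_A P_in_A S_in_A

lemma rep_closed: "a \<in> carrier A \<Longrightarrow> x \<in> carrier H \<Longrightarrow> \<pi> a x \<in> carrier H"
  using representation
  by (auto simp: cstar_representation_def bounded_operator_def linear_map_def)

lemma rep_smult: "a \<in> carrier A \<Longrightarrow> x \<in> carrier H \<Longrightarrow> \<pi> a (c \<odot> x) = c \<odot> \<pi> a x"
  using representation
  by (auto simp: cstar_representation_def bounded_operator_def linear_map_def)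

lemma rep_zero_vector: "a \<in> carrier A \<Longrightarrow> \<pi> a \<zero> = \<zero>"
  using rep_smult[of a \<zero> 0] rep_closed[of a \<zero>] by simp

lemma rep_mult:
  "\<lbrakk>a \<in> carrier A; b \<in> carrier A; x \<in> carrier H\<rbrakk> \<Longrightarrow> \<pi> (a \<otimes>\<^bsub>A\<^esub> b) x = \<pi> a (\<pi> b x)"
  using representation by (simp add: cstar_representation_def)

lemma rep_add:
  "\<lbrakk>a \<in> carrier A; b \<in> carrier A; x \<in> carrier H\<rbrakk> \<Longrightarrow> \<pi> (a \<oplus>\<^bsub>A\<^esub> b) x = \<pi> a x \<oplus> \<pi> b x"
  using representation by (simp add: cstar_representation_def)

lemma rep_scale: "a \<in> carrier A \<Longrightarrow> x \<in> carrier H \<Longrightarrow> \<pi> (c \<odot>\<^bsub>A\<^esub> a) x = c \<odot> \<pi> a x"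
  using representation by (simp add: cstar_representation_def)

lemma rep_zero:
  assumes "x \<in> carrier H"
  shows "\<pi> \<zero>\<^bsub>A\<^esub> x = \<zero>"
proof -
  interpret A: cstar_algebra A by (rule algebra)
  have "0 \<odot>\<^bsub>A\<^esub> \<zero>\<^bsub>A\<^esub> = \<zero>\<^bsub>A\<^esub>"
    by (rule A.smult_r_null) (simp add: complex_ring_def)
  then have "\<pi> \<zero>\<^bsub>A\<^esub> x = 0 \<odot> \<pi> \<zero>\<^bsub>A\<^esub> x"
    using rep_scale[OF A.M.zero_closed assms, of 0] by simp
  then show ?thesis using rep_closed[of "\<zero>\<^bsub>A\<^esub>" x] assms by simp
qed

lemma rep_adjoint:
  "\<lbrakk>a \<in> carrier A; x \<in> carrier H; y \<in> carrier H\<rbrakk> \<Longrightarrow> ip (\<pi> a x) y = ip x (\<pi> (star A a) y)"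
  using representation by (simp add: cstar_representation_def)

lemma vproj_adjoint:
  "\<lbrakk>v \<in> verts E; x \<in> carrier H; y \<in> carrier H\<rbrakk> \<Longrightarrow> ip (vproj v x) y = ip x (vproj v y)"
  using family rep_adjoint[of "P v"] by (simp add: graph_family_def is_projection_def)

lemma edge_adjoint:
  "\<lbrakk>e \<in> arcs E; x \<in> carrier H; y \<in> carrier H\<rbrakk> \<Longrightarrow> ip (edge e x) y = ip x (coedge e y)"
  by (simp add: rep_adjoint S_in_A)

lemma coedge_adjoint:
  "\<lbrakk>e \<in> arcs E; x \<in> carrier H; y \<in> carrier H\<rbrakk> \<Longrightarrow> ip (coedge e x) y = ip x (edge e y)"
  using cstar_algebra.star_star[OF algebra, of "S e"] by (simp add: rep_adjoint S_in_A star_in_A)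

lemma vproj_idem:
  "v \<in> verts E \<Longrightarrow> x \<in> carrier H \<Longrightarrow> vproj v (vproj v x) = vproj v x"
  using family rep_mult[of "P v" "P v" x] by (simp add: graph_family_def is_projection_def)

lemma vproj_orth:
  assumes "u \<in> verts E" "v \<in> verts E" "u \<noteq> v" "x \<in> carrier H"
  shows "vproj u (vproj v x) = \<zero>"
proof -
  have "P u \<otimes>\<^bsub>A\<^esub> P v = \<zero>\<^bsub>A\<^esub>" using family assms by (simp add: graph_family_def)
  then show ?thesis using rep_mult[of "P u" "P v" x] rep_zero[of x] assms P_in_A by simp
qed

lemma coedge_edge:
  assumes "e \<in> arcs E" "x \<in> carrier H"
  shows "coedge e (edge e x) = vproj (head E e) x"
proof -
  have "star A (S e) \<otimes>\<^bsub>A\<^esub> S e = P (head E e)" using family assms by (simp add: graph_family_def)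
  then show ?thesis using rep_mult[of "star A (S e)" "S e" x] assms by (simp add: in_A)
qed

lemma edge_coedge_edge:
  assumes "e \<in> arcs E" "x \<in> carrier H"
  shows "edge e (coedge e (edge e x)) = edge e x"
proof -
  have "S e \<otimes>\<^bsub>A\<^esub> star A (S e) \<otimes>\<^bsub>A\<^esub> S e = S e"
    using family assms by (simp add: graph_family_def is_partial_isometry_def)
  then have "edge e x = \<pi> (S e \<otimes>\<^bsub>A\<^esub> star A (S e) \<otimes>\<^bsub>A\<^esub> S e) x" by simp
  also have "\<dots> = edge e (coedge e (edge e x))"
    using assms by (simp add: rep_mult rep_closed in_A)
  finally show ?thesis by simp
qed

lemma coedge_edge_orth:
  assumes e: "e \<in> arcs E" and d: "d \<in> arcs E" and "e \<noteq> d" and x: "x \<in> carrier H"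
  shows "coedge e (edge d x) = \<zero>"
proof -
  define y where "y = edge d x"
  have y: "y \<in> carrier H" using d x by (simp add: y_def rep_closed in_A)
  have y': "coedge e y \<in> carrier H" using e y by (simp add: rep_closed in_A)
  have "(S e \<otimes>\<^bsub>A\<^esub> star A (S e)) \<otimes>\<^bsub>A\<^esub> (S d \<otimes>\<^bsub>A\<^esub> star A (S d)) = \<zero>\<^bsub>A\<^esub>"
    using family e d \<open>e \<noteq> d\<close> by (simp add: graph_family_def)
  moreover have "\<pi> ((S e \<otimes>\<^bsub>A\<^esub> star A (S e)) \<otimes>\<^bsub>A\<^esub> (S d \<otimes>\<^bsub>A\<^esub> star A (S d))) y
      = edge e (coedge e (edge d (coedge d y)))"
    using e d y by (simp add: rep_mult rep_closed in_A)
  ultimately have "edge e (coedge e y) = \<zero>"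
    using rep_zero[OF y] edge_coedge_edge[OF d x] by (simp add: y_def)
  then have "ip (coedge e y) (coedge e y) = 0"
    using edge_adjoint[OF e y' y] y by simp
  then show ?thesis using inner_eq_zero[OF y'] by (simp add: y_def)
qed

text \<open>
  For \<open>z\<close> orthogonal to the range of \<open>P\<^sub>v\<close>, where \<open>v\<close> is the source of \<open>e\<close>, positivity of \<open>P\<^sub>v - S\<^sub>e S\<^sub>e\<^sup>*\<close> gives
  \<open>\<parallel>S\<^sub>e\<^sup>* z\<parallel>\<^sup>2 \<le> \<langle>P\<^sub>v z, z\<rangle> = 0\<close>.
\<close>

lemma coedge_eq_zero:
  assumes e: "e \<in> arcs E" and z: "z \<in> carrier H" and "vproj (tail E e) z = \<zero>"
  shows "coedge e z = \<zero>"
proof -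
  interpret A: cstar_algebra A by (rule algebra)
  define q where "q = S e \<otimes>\<^bsub>A\<^esub> star A (S e)"
  define p where "p = P (tail E e)"
  have q: "q \<in> carrier A" using e by (simp add: q_def in_A)
  have p: "p \<in> carrier A" using e by (simp add: p_def in_A)
  obtain c where c: "c \<in> carrier A" "p \<ominus>\<^bsub>A\<^esub> q = star A c \<otimes>\<^bsub>A\<^esub> c"
    using family e
    by (auto simp: graph_family_def cstar_le_def p_def q_def)
  have cc: "star A c \<otimes>\<^bsub>A\<^esub> c \<in> carrier A" using c(1) by (simp add: in_A)
  have "p = (p \<ominus>\<^bsub>A\<^esub> q) \<oplus>\<^bsub>A\<^esub> q"
    using p q by (simp add: a_minus_def A.M.a_assoc A.M.l_neg)
  then have "p = (star A c \<otimes>\<^bsub>A\<^esub> c) \<oplus>\<^bsub>A\<^esub> q" by (simp add: c(2))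
  then have "\<zero> = \<pi> (star A c) (\<pi> c z) \<oplus> edge e (coedge e z)"
    using assms(3) rep_add[OF cc q z] c(1) e z by (simp add: p_def q_def rep_mult in_A)
  then have "0 = ip (\<pi> (star A c) (\<pi> c z)) z + ip (edge e (coedge e z)) z"
    using inner_zero_left[OF z] inner_add_left[of "\<pi> (star A c) (\<pi> c z)" "edge e (coedge e z)" z]
      c(1) e z by (simp add: rep_closed in_A)
  also have "\<dots> = ip (\<pi> c z) (\<pi> c z) + ip (coedge e z) (coedge e z)"
    using c(1) e z A.star_star[OF c(1)]
    by (simp add: rep_adjoint[of "star A c"] edge_adjoint rep_closed in_A)
  finally have "Re (ip (\<pi> c z) (\<pi> c z)) + Re (ip (coedge e z) (coedge e z)) = 0"
    unfolding plus_complex.sel(1)[symmetric] by simp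
  then have "Re (ip (coedge e z) (coedge e z)) = 0"
    using inner_nonneg[of "\<pi> c z"] inner_nonneg[of "coedge e z"] c(1) e z
    by (simp add: rep_closed in_A)
  then show ?thesis
    using hnorm_eq_zero[of "coedge e z"] e z by (simp add: hnorm_def rep_closed in_A)
qed

lemma vproj_edge:
  assumes e: "e \<in> arcs E" and x: "x \<in> carrier H"
  shows "vproj (tail E e) (edge e x) = edge e x"
proof (rule eq_by_inner)
  show closed: "edge e x \<in> carrier H" "vproj (tail E e) (edge e x) \<in> carrier H"
    using e x by (simp_all add: rep_closed in_A)
  fix w assume w: "w \<in> carrier H"
  define p where "p = vproj (tail E e) w"
  define z where "z = w \<ominus> p"
  have p: "p \<in> carrier H" using e w by (simp add: p_def rep_closed in_A)
  have z: "z \<in> carrier H" using p w by (simp add: z_def)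
  have "ip (vproj (tail E e) z) u = ip \<zero> u" if u: "u \<in> carrier H" for u
  proof -
    have pu: "vproj (tail E e) u \<in> carrier H" using e u by (simp add: rep_closed in_A)
    have "ip (vproj (tail E e) z) u = ip w (vproj (tail E e) u) - ip p (vproj (tail E e) u)"
      using vproj_adjoint[OF tail_vert[OF e] z u] inner_diff_left[OF w p pu] by (simp add: z_def)
    also have "ip p (vproj (tail E e) u) = ip w (vproj (tail E e) u)"
      using vproj_adjoint[OF tail_vert[OF e] w pu] vproj_idem[OF tail_vert[OF e] u]
      by (simp add: p_def)
    finally show ?thesis using u by simp
  qed
  then have "vproj (tail E e) z = \<zero>"
    using e z by (intro eq_by_inner) (simp_all add: rep_closed in_A)
  then have "coedge e z = \<zero>" by (rule coedge_eq_zero[OF e z])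
  then have "ip (edge e x) z = 0" using edge_adjoint[OF e x z] x by simp
  then have "ip (edge e x) w = ip (edge e x) p"
    using inner_diff_right[OF w p closed(1)] by (simp add: z_def)
  then show "ip (vproj (tail E e) (edge e x)) w = ip (edge e x) w"
    using vproj_adjoint[OF tail_vert[OF e] closed(1) w] by (simp add: p_def)
qed

end


section \<open>An orthonormal basis permuted by the edges\<close>

context graph_representation
begin

text \<open>
  The part of the range of \<open>P\<^sub>v\<close> that is orthogonal to the ranges of all \<open>S\<^sub>e\<close> with source \<open>v\<close>. It is
  zero if \<open>v\<close> emits a finite, nonzero number of edges.
\<close>

definition sink_space :: "'v \<Rightarrow> 'h set" where
  "sink_space v = {x \<in> carrier H. vproj v x = x \<and> (\<forall>e\<in>out_arcs E v. coedge e x = \<zero>)}"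

text \<open>
  The orthogonal complement of the ranges of all \<open>P\<^sub>v\<close>; it is nonzero exactly for degenerate
  representations.
\<close>

definition outer_space :: "'h set" where
  "outer_space = {x \<in> carrier H. \<forall>v\<in>verts E. vproj v x = \<zero>}"

text \<open>
  The vectors \<open>S\<^sub>p c\<close>, where \<open>p\<close> is a directed path from \<open>v\<close> to some vertex \<open>u\<close> and \<open>c \<in> C u\<close>.
\<close>

inductive path_vector :: "('v \<Rightarrow> 'h set) \<Rightarrow> 'v \<Rightarrow> 'h \<Rightarrow> bool" for C where
  sink: "\<lbrakk>v \<in> verts E; c \<in> C v\<rbrakk> \<Longrightarrow> path_vector C v c"
| arc: "\<lbrakk>e \<in> arcs E; path_vector C (head E e) b\<rbrakk> \<Longrightarrow> path_vector C (tail E e) (edge e b)"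

lemma ex_basis_sink_space:
  assumes "v \<in> verts E"
  shows "\<exists>B. orthonormal_basis_of H (sink_space v) B"
proof (rule ex_orthonormal_basis_of)
  show "c \<odot> x \<in> sink_space v" if "x \<in> sink_space v" for c x
    using that assms by (auto simp: sink_space_def rep_smult in_A)
qed (auto simp: sink_space_def)

lemma ex_basis_outer_space: "\<exists>B. orthonormal_basis_of H outer_space B"
proof (rule ex_orthonormal_basis_of)
  show "c \<odot> x \<in> outer_space" if "x \<in> outer_space" for c x
    using that by (auto simp: outer_space_def rep_smult in_A)
qed (auto simp: outer_space_def)

end

text \<open>
  The source of an edge is larger than its range in the relation of the last assumption, so that
  well-foundedness means that every directed path, followed in the direction of its edges, ends.
\<close>

locale path_basis = graph_representation H E A P S \<pi>
  for H :: "('h, 'n) inner_space_scheme" (structure)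
    and E :: "('v, 'e) pre_digraph" and A :: "('a, 'm) star_algebra_scheme"
    and P :: "'v \<Rightarrow> 'a" and S :: "'e \<Rightarrow> 'a" and \<pi> :: "'a \<Rightarrow> 'h \<Rightarrow> 'h" +
  fixes C :: "'v \<Rightarrow> 'h set" and B0 :: "'h set"
  assumes sink_basis: "v \<in> verts E \<Longrightarrow> orthonormal_basis_of H (sink_space v) (C v)"
    and outer_basis: "orthonormal_basis_of H outer_space B0"
    and no_infinite_path: "wf {(head E e, tail E e) | e. e \<in> arcs E}"
begin

abbreviation vertex_basis :: "'v \<Rightarrow> 'h set" where
  "vertex_basis v \<equiv> {b. path_vector C v b}"

abbreviation edge_basis :: "'e \<Rightarrow> 'h set" where
  "edge_basis e \<equiv> edge e ` vertex_basis (head E e)"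

definition full_basis :: "'h set" where
  "full_basis = B0 \<union> (\<Union>v. vertex_basis v)"

lemma sink_vector:
  assumes "v \<in> verts E" "c \<in> C v"
  shows "c \<in> carrier H" "vproj v c = c" "\<And>e. e \<in> out_arcs E v \<Longrightarrow> coedge e c = \<zero>"
  using sink_basis[OF assms(1)] assms(2) by (auto simp: orthonormal_basis_of_def sink_space_def)

lemma path_vector_range:
  assumes "path_vector C v b"
  shows "v \<in> verts E \<and> b \<in> carrier H \<and> vproj v b = b"
  using assms
proof induction
  case (sink v c)
  then show ?case using sink_vector by blast
next
  case (arc e b)
  then show ?case by (simp add: vproj_edge rep_closed in_A)
qed

lemma coedge_edge_path_vector:
  assumes "e \<in> arcs E" "path_vector C (head E e) b"
  shows "coedge e (edge e b) = b"
  using path_vector_range[OF assms(2)] coedge_edge[OF assms(1)] by simp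

text \<open>
  A path vector at \<open>v\<close> is in the range of \<open>S\<^sub>e\<close> if the path starts with \<open>e\<close>; otherwise the path has
  length zero, starts with a different edge, or starts at a different vertex, and in each of these
  cases the vector is orthogonal to that range.
\<close>

lemma coedge_path_vector:
  assumes v: "path_vector C v b" and e: "e \<in> arcs E" and "b \<notin> edge_basis e"
  shows "coedge e b = \<zero>"
proof (cases "v = tail E e")
  case True
  from v show ?thesis
  proof cases
    case sink
    then show ?thesis using sink_vector(3) e True by simp
  next
    case (arc d c)
    then have "d \<noteq> e" using assms(3) by blast
    then show ?thesis using arc e path_vector_range[OF arc(4)] by (simp add: coedge_edge_orth)
  qed
next
  case False
  have b: "v \<in> verts E" "b \<in> carrier H" "vproj v b = b" using path_vector_range[OF v] by auto
  then have "vproj (tail E e) b = \<zero>"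
    using vproj_orth[of "tail E e" v b] False e by simp
  then show ?thesis using e b by (intro coedge_eq_zero)
qed

lemma path_vector_unit:
  assumes "path_vector C v b"
  shows "ip b b = 1"
  using assms
proof induction
  case (sink v c)
  then show ?case using sink_basis by (auto simp: orthonormal_basis_of_def orthonormal_def)
next
  case (arc e b)
  then show ?case
    using path_vector_range[OF arc(2)] coedge_edge_path_vector[OF arc(1,2)]
    by (simp add: edge_adjoint rep_closed in_A)
qed

lemma path_vector_orth_vertex:
  assumes b: "path_vector C u b" and c: "path_vector C v c" and "u \<noteq> v"
  shows "ip b c = 0"
proof -
  note * = path_vector_range[OF b] path_vector_range[OF c]
  then have "ip b c = ip b (vproj u c)" using vproj_adjoint[of u b c] by simp
  also have "vproj u c = \<zero>" using * vproj_orth[of u v c] \<open>u \<noteq> v\<close> by simp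
  finally show ?thesis using * by simp
qed

text \<open>
  Remove the common initial part of the two paths. Then both have length zero, they start with
  different edges, or exactly one has length zero; in the last case the other vector is in the range
  of some \<open>S\<^sub>e\<close>, to which the sink space is orthogonal.
\<close>

lemma path_vector_orth:
  assumes "path_vector C v b" "path_vector C v c" "b \<noteq> c"
  shows "ip b c = 0"
  using assms
proof (induction arbitrary: c)
  case (sink v b)
  note b = sink_vector[OF sink(1,2)]
  from sink(3) show ?case
  proof cases
    case sink
    then show ?thesis
      using sink_basis[OF sink(1)] \<open>b \<in> C v\<close> \<open>b \<noteq> c\<close>
      by (simp add: orthonormal_basis_of_def orthonormal_def)
  next
    case (arc e c')
    then have "coedge e b = \<zero>" using b(3) by simp
    then show ?thesis
      using arc b(1) path_vector_range[OF arc(4)] coedge_adjoint[of e b c'] by simp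
  qed
next
  case (arc e b)
  note b = path_vector_range[OF arc(2)]
  from arc(4) show ?case
  proof cases
    case sink
    then have "coedge e c = \<zero>" "c \<in> carrier H" using sink_vector[OF sink] arc(1) by auto
    then show ?thesis using arc(1) b edge_adjoint[of e b c] by simp
  next
    case d: (arc d c')
    note c' = path_vector_range[OF d(4)]
    have dc: "edge d c' \<in> carrier H" using d c' by (simp add: rep_closed in_A)
    show ?thesis
    proof (cases "d = e")
      case True
      then have "b \<noteq> c'" using arc(5) d(2) by blast
      then have "ip b c' = 0" using arc(3) d(4) True by simp
      then show ?thesis
        using edge_adjoint[OF arc(1), of b "edge d c'"] b dc True d
          coedge_edge_path_vector[OF d(3,4)] by simp
    next
      case False
      then show ?thesis
        using edge_adjoint[OF arc(1), of b "edge d c'"] b dc d c'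
          coedge_edge_orth[OF arc(1) d(3)] by simp
    qed
  qed
qed

text \<open>
  This is where infinite paths have to be excluded: along an infinite path the projections
  \<open>S\<^sub>p S\<^sub>p\<^sup>*\<close> of its initial parts \<open>p\<close> could decrease to a nonzero projection, whose range would be
  orthogonal to every path vector.
\<close>

lemma path_vectors_total:
  assumes "v \<in> verts E" "x \<in> carrier H" "vproj v x = x"
    and "\<And>b. path_vector C v b \<Longrightarrow> ip x b = 0"
  shows "x = \<zero>"
  using assms
proof (induction v arbitrary: x rule: wf_induct_rule[OF no_infinite_path])
  case (1 v)
  have "coedge e x = \<zero>" if "e \<in> out_arcs E v" for e
  proof -
    have e: "e \<in> arcs E" "tail E e = v" using that by auto
    have cx: "coedge e x \<in> carrier H" using e 1(3) by (simp add: rep_closed in_A)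
    have "vproj (head E e) (coedge e x) = coedge e x"
    proof (rule eq_by_inner)
      fix w assume w: "w \<in> carrier H"
      have "edge e (vproj (head E e) w) = edge e w"
        using edge_coedge_edge[OF e(1) w] coedge_edge[OF e(1) w] by simp
      then show "ip (vproj (head E e) (coedge e x)) w = ip (coedge e x) w"
        using e w cx 1(3) by (simp add: vproj_adjoint coedge_adjoint rep_closed in_A)
    qed (use e cx in \<open>simp_all add: rep_closed in_A\<close>)
    moreover have "ip (coedge e x) b = 0" if b: "path_vector C (head E e) b" for b
      using 1(5)[of "edge e b"] path_vector.arc[OF e(1) b] e path_vector_range[OF b] 1(3)
      by (simp add: coedge_adjoint)
    ultimately show ?thesis using 1(1)[of "head E e" "coedge e x"] e cx by auto
  qed
  then have "x \<in> sink_space v" using 1 by (simp add: sink_space_def)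
  moreover have "\<forall>c\<in>C v. ip x c = 0" using 1(5) path_vector.sink[OF 1(2)] by blast
  ultimately show ?case using sink_basis[OF 1(2)] by (simp add: orthonormal_basis_of_def)
qed

lemma outer_vector:
  assumes "b \<in> B0"
  shows "b \<in> carrier H" "\<And>v. v \<in> verts E \<Longrightarrow> vproj v b = \<zero>"
  using outer_basis assms by (auto simp: orthonormal_basis_of_def outer_space_def)

lemma outer_path_orth:
  assumes b: "b \<in> B0" and c: "path_vector C v c"
  shows "ip b c = 0" "ip c b = 0"
proof -
  note * = path_vector_range[OF c] outer_vector[OF b]
  then show "ip b c = 0" using vproj_adjoint[of v b c] by simp
  then show "ip c b = 0" using inner_commute[of c b] * by simp
qed

lemma full_basis_orthonormal: "orthonormal H full_basis"
  unfolding orthonormal_def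
proof (intro conjI ballI)
  show "full_basis \<subseteq> carrier H"
    using outer_vector path_vector_range by (auto simp: full_basis_def)
  fix b c assume "b \<in> full_basis" "c \<in> full_basis"
  then consider "b \<in> B0" "c \<in> B0" | v where "b \<in> B0" "path_vector C v c"
    | v where "path_vector C v b" "c \<in> B0" | u v where "path_vector C u b" "path_vector C v c"
    by (auto simp: full_basis_def)
  then show "ip b c = (if b = c then 1 else 0)"
  proof cases
    case 1
    then show ?thesis
      using outer_basis by (simp add: orthonormal_basis_of_def orthonormal_def)
  next
    case 2
    then show ?thesis using outer_path_orth path_vector_unit by force
  next
    case 3
    then show ?thesis using outer_path_orth path_vector_unit by force
  next
    case 4
    then show ?thesis
      using path_vector_unit[OF 4(1)] path_vector_orth[of u b c] path_vector_orth_vertex[OF 4]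
      by (cases "u = v"; cases "b = c") auto
  qed
qed

lemma full_basis_basis: "orthonormal_basis_of H (carrier H) full_basis"
proof -
  have "x = \<zero>" if x: "x \<in> carrier H" and orth: "\<forall>b\<in>full_basis. ip x b = 0" for x
  proof -
    have "vproj v x = \<zero>" if v: "v \<in> verts E" for v
    proof (rule path_vectors_total[OF v])
      show "vproj v x \<in> carrier H" "vproj v (vproj v x) = vproj v x"
        using v x by (simp_all add: vproj_idem rep_closed in_A)
      show "ip (vproj v x) b = 0" if b: "path_vector C v b" for b
        using orth b v x path_vector_range[OF b] by (auto simp: vproj_adjoint full_basis_def)
    qed
    then have "x \<in> outer_space" using x by (simp add: outer_space_def)
    then show ?thesis
      using outer_basis orth by (simp add: orthonormal_basis_of_def full_basis_def)
  qed
  moreover have "full_basis \<subseteq> carrier H"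
    using full_basis_orthonormal by (simp add: orthonormal_def)
  ultimately show ?thesis
    using full_basis_orthonormal by (simp add: orthonormal_basis_of_def)
qed

lemma vproj_full_basis:
  assumes v: "v \<in> verts E" and b: "b \<in> full_basis"
  shows "vproj v b = (if b \<in> vertex_basis v then b else \<zero>)"
proof -
  consider "b \<in> B0" | u where "path_vector C u b"
    using b by (auto simp: full_basis_def)
  then show ?thesis
  proof cases
    case 1
    then have "vproj v b = \<zero>" using outer_vector v by blast
    then show ?thesis using path_vector_range[of v b] by auto
  next
    case 2
    note u = path_vector_range[OF 2]
    show ?thesis
    proof (cases "u = v")
      case False
      then have "vproj v b = \<zero>" using u v vproj_orth[of v u b] by simp
      then show ?thesis using path_vector_range[of v b] by auto
    qed (use 2 u in simp)
  qed
qed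

lemma coedge_full_basis:
  assumes e: "e \<in> arcs E" and b: "b \<in> full_basis" "b \<notin> edge_basis e"
  shows "coedge e b = \<zero>"
proof -
  consider "b \<in> B0" | u where "path_vector C u b"
    using b by (auto simp: full_basis_def)
  then show ?thesis
  proof cases
    case 1
    then show ?thesis using outer_vector[OF 1] e by (intro coedge_eq_zero) auto
  next
    case 2
    then show ?thesis using e b(2) by (rule coedge_path_vector)
  qed
qed

lemma vertex_basis_disjoint:
  assumes "u \<noteq> v"
  shows "vertex_basis u \<inter> vertex_basis v = {}"
  using path_vector_orth_vertex[OF _ _ assms] path_vector_unit by force

lemma edge_basis_disjoint:
  assumes e: "e \<in> arcs E" and d: "d \<in> arcs E" and "e \<noteq> d"
  shows "edge_basis e \<inter> edge_basis d = {}"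
proof (rule ccontr)
  assume "edge_basis e \<inter> edge_basis d \<noteq> {}"
  then obtain b c where b: "path_vector C (head E e) b" and c: "path_vector C (head E d) c"
    and eq: "edge e b = edge d c" by blast
  have "b = \<zero>"
    using coedge_edge_path_vector[OF e b] coedge_edge_orth[OF e d \<open>e \<noteq> d\<close>]
      path_vector_range[OF c] eq by simp
  then show False using path_vector_unit[OF b] by simp
qed

lemma edge_basis_subset: "e \<in> arcs E \<Longrightarrow> edge_basis e \<subseteq> vertex_basis (tail E e)"
  using path_vector.arc by blast

lemma rep_finsum_zero:
  assumes "finite F" "f \<in> F \<rightarrow> carrier A" "x \<in> carrier H" "\<And>e. e \<in> F \<Longrightarrow> \<pi> (f e) x = \<zero>"
  shows "\<pi> (\<Oplus>\<^bsub>A\<^esub>e\<in>F. f e) x = \<zero>"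
proof -
  interpret A: cstar_algebra A by (rule algebra)
  show ?thesis
    using assms
  proof (induction F rule: finite_induct)
    case empty
    then show ?case by (simp add: rep_zero)
  next
    case (insert e F)
    have "(\<Oplus>\<^bsub>A\<^esub>e\<in>F. f e) \<in> carrier A" using insert by (intro A.M.finsum_closed) auto
    then show ?case using insert by (simp add: rep_add Pi_iff)
  qed
qed

text \<open>
  By the summation relation at \<open>v\<close>, a vector of the sink space of \<open>v\<close> is annihilated by \<open>P\<^sub>v\<close>. Hence
  no path vector at \<open>v\<close> belongs to a path of length zero.
\<close>

lemma regular_vertex_basis:
  assumes v: "v \<in> verts E" and fin: "finite (out_arcs E v)" "out_arcs E v \<noteq> {}"
  shows "vertex_basis v = (\<Union>e\<in>out_arcs E v. edge_basis e)"
proof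
  show "vertex_basis v \<subseteq> (\<Union>e\<in>out_arcs E v. edge_basis e)"
  proof
    fix b assume "b \<in> vertex_basis v"
    then have "path_vector C v b" by simp
    then show "b \<in> (\<Union>e\<in>out_arcs E v. edge_basis e)"
    proof cases
      case sink
      note b = sink_vector[OF sink]
      have "P v = (\<Oplus>\<^bsub>A\<^esub>e\<in>out_arcs E v. S e \<otimes>\<^bsub>A\<^esub> star A (S e))"
        using family v fin by (simp add: graph_family_def)
      moreover have "\<pi> (\<Oplus>\<^bsub>A\<^esub>e\<in>out_arcs E v. S e \<otimes>\<^bsub>A\<^esub> star A (S e)) b = \<zero>"
        using b fin(1) by (intro rep_finsum_zero) (auto simp: rep_mult rep_zero_vector in_A)
      ultimately have "b = \<zero>" using b(2) by simp
      moreover have "ip b b = 1" by (rule path_vector_unit) fact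
      ultimately show ?thesis by simp
    qed auto
  qed
  show "(\<Union>e\<in>out_arcs E v. edge_basis e) \<subseteq> vertex_basis v"
    using edge_basis_subset by fastforce
qed

end


section \<open>The branching system on an orthonormal basis\<close>

lemma image_RN_deriv_count_space:
  assumes "inj_on f D" "D \<subseteq> I" "f ` D \<subseteq> I"
  shows "image_RN_deriv (count_space I) D f (\<lambda>_. 1)"
  unfolding image_RN_deriv_def
proof (intro conjI ballI impI)
  fix C assume C: "C \<in> sets (count_space I)" "C \<subseteq> D"
  then have fC: "f ` C \<subseteq> I" using assms(3) by auto
  then show "f ` C \<in> sets (count_space I)" by simp
  have inj: "inj_on f C" using assms(1) C(2) by (rule inj_on_subset)
  have "emeasure (count_space I) (f ` C) = emeasure (count_space I) C"
    using C fC finite_image_iff[OF inj] card_image[OF inj] by (simp add: emeasure_count_space)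
  then show "emeasure (count_space I) (f ` C) = (\<integral>\<^sup>+x\<in>C. ennreal 1 \<partial>count_space I)"
    using C by simp
qed auto

lemma l2_class_count_space_eqD:
  assumes "l2_class (count_space I) \<phi> = l2_class (count_space I) \<psi>"
    "\<phi> \<in> square_integrable (count_space I)" "\<psi> \<in> square_integrable (count_space I)" "x \<in> I"
  shows "\<phi> x = \<psi> x"
  using assms l2_rep_count_space[of \<phi> I x] l2_rep_count_space[of \<psi> I x] by simp

context path_basis
begin

text \<open>
  Since \<open>S\<^sub>e\<close> maps the basis of the range of \<open>P\<^bsub>r(e)\<^esub>\<close> bijectively to a part of the whole basis, the maps
  \<open>f\<^sub>e\<close> are bijections that preserve counting measure, and all derivatives are 1.
\<close>

definition basis_system :: "('h \<Rightarrow> 'x) \<Rightarrow> ('x, 'v, 'e) branching_data" where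
  "basis_system g =
     \<lparr> bs_measure = count_space (g ` full_basis),
       bs_R = (\<lambda>e. g ` edge_basis e),
       bs_D = (\<lambda>v. g ` vertex_basis v),
       bs_f = (\<lambda>e r. g (edge e (inv_into full_basis g r))),
       bs_f_inv = (\<lambda>e r. g (coedge e (inv_into full_basis g r))),
       bs_Phi = (\<lambda>_ _. 1),
       bs_Phi_inv = (\<lambda>_ _. 1) \<rparr>"

lemma vertex_basis_full: "vertex_basis v \<subseteq> full_basis"
  by (auto simp: full_basis_def)

lemma edge_basis_full: "e \<in> arcs E \<Longrightarrow> edge_basis e \<subseteq> full_basis"
  using edge_basis_subset vertex_basis_full by blast

lemma branching_system_basis_system:
  assumes inj: "inj_on g full_basis"
  shows "branching_system E (basis_system g)"
proof -
  define h where "h = inv_into full_basis g"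
  have h: "h (g b) = b" if "b \<in> full_basis" for b
    unfolding h_def using inj that by (rule inv_into_f_f)
  have D_full: "g ` vertex_basis v \<subseteq> g ` full_basis" for v
    using vertex_basis_full by (rule image_mono)
  have R_full: "g ` edge_basis e \<subseteq> g ` full_basis" if "e \<in> arcs E" for e
    using edge_basis_full[OF that] by (rule image_mono)
  have disjoint: "g ` U \<inter> g ` V = {}" if "U \<subseteq> full_basis" "V \<subseteq> full_basis" "U \<inter> V = {}" for U V
    using inj_on_image_Int[OF inj that(1,2)] that(3) by simp
  have f: "g (edge e (h (g b))) = g (edge e b)" if "path_vector C v b" for e v b
    using h[of b] that vertex_basis_full[of v] by auto
  have f_inv: "g (coedge e (h (g (edge e b)))) = g b"
    if "e \<in> arcs E" "path_vector C (head E e) b" for e b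
    using h[of "edge e b"] that edge_basis_full[OF that(1)] coedge_edge_path_vector[OF that] by auto
  have bij: "bij_betw (\<lambda>r. g (edge e (h r))) (g ` vertex_basis (head E e)) (g ` edge_basis e)"
    "bij_betw (\<lambda>r. g (coedge e (h r))) (g ` edge_basis e) (g ` vertex_basis (head E e))"
    if e: "e \<in> arcs E" for e
    by (rule bij_betw_byWitness[where f' = "\<lambda>r. g (coedge e (h r))"]; use e in \<open>auto simp: f f_inv\<close>)
      (rule bij_betw_byWitness[where f' = "\<lambda>r. g (edge e (h r))"]; use e in \<open>auto simp: f f_inv\<close>)
  note simps = basis_system_def h_def[symmetric] eq_ae_def AE_count_space restrict_count_space
  show ?thesis
  proof
    fix e assume e: "e \<in> arcs E"
    show "bs_R (basis_system g) e \<in> sets (bs_measure (basis_system g))"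
      using R_full[OF e] by (simp add: simps)
    show "bs_R (basis_system g) e - bs_D (basis_system g) (tail E e)
        \<in> null_sets (bs_measure (basis_system g))"
    proof -
      have "bs_R (basis_system g) e - bs_D (basis_system g) (tail E e) = {}"
        using edge_basis_subset[OF e] by (auto simp: simps)
      then show ?thesis by (simp only: null_sets.empty_sets)
    qed
    show "bs_f (basis_system g) e
        \<in> restrict_space (bs_measure (basis_system g)) (bs_D (basis_system g) (head E e))
          \<rightarrow>\<^sub>M restrict_space (bs_measure (basis_system g)) (bs_R (basis_system g) e)"
      using bij_betw_imp_funcset[OF bij(1)[OF e]]
      by (simp add: simps Int_absorb2[OF D_full] Int_absorb2[OF R_full[OF e]])
    show "eq_ae (bs_measure (basis_system g))
        (bs_f (basis_system g) e ` bs_D (basis_system g) (head E e)) (bs_R (basis_system g) e)"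
      using bij(1)[OF e] by (simp add: simps bij_betw_def)
    show "image_RN_deriv (bs_measure (basis_system g)) (bs_D (basis_system g) (head E e))
        (bs_f (basis_system g) e) (bs_Phi (basis_system g) e)"
      using image_RN_deriv_count_space[OF bij_betw_imp_inj_on[OF bij(1)[OF e]] D_full]
        bij_betw_imp_surj_on[OF bij(1)[OF e]] R_full[OF e] by (simp add: simps)
    show "AE x in bs_measure (basis_system g). x \<in> bs_D (basis_system g) (head E e)
        \<longrightarrow> 0 < bs_Phi (basis_system g) e x"
      by (simp add: simps)
    show "bs_f_inv (basis_system g) e
        \<in> restrict_space (bs_measure (basis_system g)) (bs_R (basis_system g) e)
          \<rightarrow>\<^sub>M restrict_space (bs_measure (basis_system g)) (bs_D (basis_system g) (head E e))"
      using bij_betw_imp_funcset[OF bij(2)[OF e]]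
      by (simp add: simps Int_absorb2[OF D_full] Int_absorb2[OF R_full[OF e]])
    show "AE x in bs_measure (basis_system g). x \<in> bs_R (basis_system g) e
        \<longrightarrow> bs_f (basis_system g) e (bs_f_inv (basis_system g) e x) = x"
      using e by (auto simp: simps f f_inv)
    show "AE x in bs_measure (basis_system g). x \<in> bs_D (basis_system g) (head E e)
        \<longrightarrow> bs_f_inv (basis_system g) e (bs_f (basis_system g) e x) = x"
      using e by (auto simp: simps f f_inv)
    show "image_RN_deriv (bs_measure (basis_system g)) (bs_R (basis_system g) e)
        (bs_f_inv (basis_system g) e) (bs_Phi_inv (basis_system g) e)"
      using image_RN_deriv_count_space[OF bij_betw_imp_inj_on[OF bij(2)[OF e]] R_full[OF e]]
        bij_betw_imp_surj_on[OF bij(2)[OF e]] D_full by (simp add: simps)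
  next
    fix v assume "v \<in> verts E"
    show "bs_D (basis_system g) v \<in> sets (bs_measure (basis_system g))"
      using D_full by (simp add: simps)
  next
    fix e d assume "e \<in> arcs E" "d \<in> arcs E" "d \<noteq> e"
    then have "g ` edge_basis e \<inter> g ` edge_basis d = {}"
      by (intro disjoint edge_basis_full edge_basis_disjoint) auto
    then show "eq_ae (bs_measure (basis_system g))
        (bs_R (basis_system g) e \<inter> bs_R (basis_system g) d) {}"
      by (simp add: simps)
  next
    fix u v assume "u \<in> verts E" "v \<in> verts E" "u \<noteq> v"
    then have "g ` vertex_basis u \<inter> g ` vertex_basis v = {}"
      by (intro disjoint vertex_basis_full vertex_basis_disjoint)
    then show "eq_ae (bs_measure (basis_system g))
        (bs_D (basis_system g) u \<inter> bs_D (basis_system g) v) {}"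
      by (simp add: simps)
  next
    fix v assume "v \<in> verts E" "finite (out_arcs E v)" "out_arcs E v \<noteq> {}"
    from regular_vertex_basis[OF this]
    have "g ` vertex_basis v = (\<Union>e\<in>out_arcs E v. g ` edge_basis e)"
      by (simp only: image_UN)
    then show "eq_ae (bs_measure (basis_system g)) (bs_D (basis_system g) v)
        (\<Union>e\<in>out_arcs E v. bs_R (basis_system g) e)"
      by (simp add: simps)
  qed
qed

text \<open>
  Coordinates turn the formulas of the induced representation into statements on \<open>S\<^sub>e\<^sup>*\<close> and \<open>P\<^sub>v\<close> at basis
  vectors: the coordinate of \<open>S\<^sub>e x\<close> at \<open>b\<close> is \<open>\<langle>x, S\<^sub>e\<^sup>* b\<rangle>\<close>, and \<open>S\<^sub>e\<^sup>* b\<close> is either zero or again a basis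
  vector.
\<close>

lemma equivalent_to_basis_system:
  assumes sep: "separable H" and inj: "inj_on g full_basis"
  shows "\<exists>\<rho>. induced_representation E A P S (basis_system g) \<rho> \<and>
    unitarily_equivalent A H \<pi> (l2_space (bs_measure (basis_system g))) \<rho>"
proof (intro exI conjI)
  define I where "I = g ` full_basis"
  define h where "h = inv_into full_basis g"
  define U where "U = coordinate_map H full_basis g"
  define \<rho> where "\<rho> = transported_representation H U \<pi>"
  have h: "h (g b) = b" if "b \<in> full_basis" for b
    unfolding h_def using inj that by (rule inv_into_f_f)
  have carrier: "b \<in> carrier H" if "b \<in> full_basis" for b
    using full_basis_orthonormal that by (auto simp: orthonormal_def)
  have M: "bs_measure (basis_system g) = count_space I"
    by (simp add: basis_system_def I_def)
  have U: "unitary_map H (l2_space (count_space I)) U"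
    unfolding U_def I_def using full_basis_basis orthonormal_countable[OF sep full_basis_orthonormal] inj
    by (rule coordinate_map_unitary)
  have \<rho>: "\<rho> a (U x) = U (\<pi> a x)" if "x \<in> carrier H" for a x
    unfolding \<rho>_def by (rule transported_representation_apply[OF U that])
  show "unitarily_equivalent A H \<pi> (l2_space (bs_measure (basis_system g))) \<rho>"
    unfolding unitarily_equivalent_def M using U \<rho> by auto
  have U_eq: "U x = l2_class (count_space I) (\<lambda>r. ip x (h r))" for x
    by (simp add: U_def coordinate_map_def I_def h_def)
  have coordinates: "\<exists>x\<in>carrier H. l2_class (count_space I) \<phi> = U x \<and> (\<forall>b\<in>full_basis. \<phi> (g b) = ip x b)"
    if \<phi>: "\<phi> \<in> square_integrable (count_space I)" for \<phi>
  proof -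
    have "l2_class (count_space I) \<phi> \<in> carrier (l2_space (count_space I))"
      using \<phi> by (simp add: l2_space_def)
    then have "l2_class (count_space I) \<phi> \<in> U ` carrier H"
      using U by (simp add: unitary_map_def bij_betw_def)
    then obtain x where x: "x \<in> carrier H" "l2_class (count_space I) \<phi> = U x" by auto
    have "\<phi> r = ip x (h r)" if "r \<in> I" for r
      using x(2) \<phi> coordinates_square_integrable[OF full_basis_orthonormal inj x(1)] that
      unfolding U_eq I_def[symmetric] h_def[symmetric] by (rule l2_class_count_space_eqD)
    then show ?thesis using x h by (auto simp: I_def)
  qed
  show "induced_representation E A P S (basis_system g) \<rho>"
    unfolding induced_representation_def M
  proof (intro conjI ballI)
    show "cstar_representation A (l2_space (count_space I)) \<rho>"
      unfolding \<rho>_def using hilbert_space_axioms U representation star_in_A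
      by (rule cstar_representation_transport)
  next
    fix e \<phi> assume e: "e \<in> arcs E" and sq: "\<phi> \<in> square_integrable (count_space I)"
    obtain x where x: "x \<in> carrier H" "l2_class (count_space I) \<phi> = U x"
      and \<phi>: "\<forall>b\<in>full_basis. \<phi> (g b) = ip x b"
      using coordinates[OF sq] by (elim bexE conjE)
    have "ip (edge e x) b = indicator (g ` edge_basis e) (g b) * \<phi> (g (coedge e b))"
      if b: "b \<in> full_basis" for b
    proof (cases "b \<in> edge_basis e")
      case True
      then obtain c where c: "path_vector C (head E e) c" "b = edge e c" by blast
      then have "coedge e b = c" using coedge_edge_path_vector[OF e] by simp
      moreover have "c \<in> full_basis" using c(1) by (auto simp: full_basis_def)
      ultimately show ?thesis
        using True x(1) e carrier[OF b] \<phi> by (simp add: edge_adjoint)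
    next
      case False
      then have "g b \<notin> g ` edge_basis e"
        using inj_on_image_mem_iff[OF inj b edge_basis_full[OF e]] by simp
      then show ?thesis
        using coedge_full_basis[OF e b False] x(1) e carrier[OF b] by (simp add: edge_adjoint)
    qed
    then show "\<rho> (S e) (l2_class (count_space I) \<phi>) = l2_class (count_space I)
        (\<lambda>r. indicator (bs_R (basis_system g) e) r *
          complex_of_real (sqrt (bs_Phi_inv (basis_system g) e r)) *
          \<phi> (bs_f_inv (basis_system g) e r))"
      unfolding x(2) \<rho>[OF x(1)] unfolding U_eq
      by (intro l2_class_count_space_cong)
        (auto simp: basis_system_def h_def[symmetric] I_def h)
  next
    fix v \<phi> assume v: "v \<in> verts E" and sq: "\<phi> \<in> square_integrable (count_space I)"
    obtain x where x: "x \<in> carrier H" "l2_class (count_space I) \<phi> = U x"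
      and \<phi>: "\<forall>b\<in>full_basis. \<phi> (g b) = ip x b"
      using coordinates[OF sq] by (elim bexE conjE)
    have "ip (vproj v x) b = indicator (g ` vertex_basis v) (g b) * \<phi> (g b)"
      if b: "b \<in> full_basis" for b
      using x(1) v carrier[OF b] vproj_full_basis[OF v b] bspec[OF \<phi> b]
        inj_on_image_mem_iff[OF inj b vertex_basis_full[of v]]
      by (simp add: vproj_adjoint indicator_def)
    then show "\<rho> (P v) (l2_class (count_space I) \<phi>) = l2_class (count_space I)
        (\<lambda>r. indicator (bs_D (basis_system g) v) r * \<phi> r)"
      unfolding x(2) \<rho>[OF x(1)] unfolding U_eq
      by (intro l2_class_count_space_cong) (auto simp: basis_system_def I_def h)
  qed
qed

end


section \<open>Finitely many levels exclude infinite directed paths\<close>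

lemma tail_peel [simp]: "tail (peel G n) = tail G"
  by (cases n) simp_all

lemma head_peel [simp]: "head (peel G n) = head G"
  by (cases n) simp_all

lemma verts_peel: "verts (peel G n) = verts G - (\<Union>k\<in>{1..n}. level G k)"
proof (induction n)
  case (Suc n)
  have "{1..Suc n} = insert (Suc n) {1..n}" by auto
  then show ?case using Suc by (auto simp: level_def)
qed simp

text \<open>
  An inner vertex of a path has an edge of the path on both sides, and if these coincide they are a
  loop; so it is not extreme. Each step of peeling can therefore remove only the first vertex and the
  first edge of the path.
\<close>

lemma infinite_path_survives_peel:
  assumes "\<And>i. f i \<in> verts G" "\<And>i. \<epsilon> i \<in> arcs G"
    and tail: "\<And>i. tail G (\<epsilon> i) = f i" and head: "\<And>i. head G (\<epsilon> i) = f (Suc i)"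
    and "n \<le> i"
  shows "f i \<in> verts (peel G n) \<and> \<epsilon> i \<in> arcs (peel G n)"
  using \<open>n \<le> i\<close>
proof (induction n arbitrary: i)
  case 0
  then show ?case using assms by simp
next
  case (Suc n)
  define K where "K = peel G n"
  have not_extreme: "f j \<notin> extreme_vertices K" if "Suc n \<le> j" for j
  proof
    assume extreme: "f j \<in> extreme_vertices K"
    define k where "k = j - 1"
    have k: "j = Suc k" "n \<le> k" using that by (simp_all add: k_def)
    have *: "\<epsilon> k \<in> in_arcs K (f j)" "\<epsilon> j \<in> out_arcs K (f j)"
      using Suc.IH[of k] Suc.IH[of j] k tail head by (auto simp: K_def)
    have "card (in_arcs K (f j) \<union> out_arcs K (f j)) = 1"
      using extreme by (simp add: extreme_vertices_def)
    then obtain a where a: "in_arcs K (f j) \<union> out_arcs K (f j) = {a}"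
      by (rule card_1_singletonE)
    have "\<epsilon> k = \<epsilon> j"
      using UnI1[OF *(1), of "out_arcs K (f j)"] UnI2[OF *(2), of "in_arcs K (f j)"]
      unfolding a by simp
    then have "loop_at K (f j)"
      using Suc.IH[of j] k tail[of j] head[of k] unfolding loop_at_def
      by (intro bexI[of _ "\<epsilon> j"]) (auto simp: K_def)
    then show False using extreme by (simp add: extreme_vertices_def)
  qed
  have "\<epsilon> i \<notin> extreme_edges K"
  proof
    assume "\<epsilon> i \<in> extreme_edges K"
    then obtain v where "v \<in> extreme_vertices K" "v = f i \<or> v = f (Suc i)"
      using tail[of i] head[of i] by (auto simp: extreme_edges_def K_def)
    then show False using not_extreme[of i] not_extreme[of "Suc i"] Suc.prems by auto
  qed
  then show ?case using Suc.IH[of i] not_extreme[of i] Suc.prems by (simp add: K_def)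
qed

text \<open>
  A directed path stays in one component. After all levels of the component have been removed, an
  infinite path would still have an edge left, which could only be a loop at the remaining vertex.
\<close>

lemma finite_levels_imp_no_infinite_path:
  assumes graph: "wf_digraph E"
    and cover: "verts E = (\<Union>i\<in>\<Delta>. Z i) \<union> isolated_vertices E"
    and maximal: "\<And>i. i \<in> \<Delta> \<Longrightarrow> connected_maximal E (Z i)"
    and levels: "\<And>i. i \<in> \<Delta> \<Longrightarrow> \<exists>m.
        Z i = (\<Union>n\<in>{1..m}. level (subgraph_on E (Z i)) n) \<or>
        (\<exists>v. v \<notin> (\<Union>n\<in>{1..m}. level (subgraph_on E (Z i)) n) \<and>
             Z i = (\<Union>n\<in>{1..m}. level (subgraph_on E (Z i)) n) \<union> {v} \<and>
             \<not> loop_at E v)"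
  shows "wf {(head E e, tail E e) | e. e \<in> arcs E}"
  unfolding wf_iff_no_infinite_down_chain
proof
  assume "\<exists>f. \<forall>i. (f (Suc i), f i) \<in> {(head E e, tail E e) | e. e \<in> arcs E}"
  then obtain f where f: "\<forall>i. (f (Suc i), f i) \<in> {(head E e, tail E e) | e. e \<in> arcs E}"
    by (elim exE)
  have "\<forall>i. \<exists>e. e \<in> arcs E \<and> tail E e = f i \<and> head E e = f (Suc i)"
  proof
    fix i
    show "\<exists>e. e \<in> arcs E \<and> tail E e = f i \<and> head E e = f (Suc i)"
      using spec[OF f, of i] by auto
  qed
  from choice[OF this] obtain \<epsilon>
    where \<epsilon>: "\<forall>i. \<epsilon> i \<in> arcs E \<and> tail E (\<epsilon> i) = f i \<and> head E (\<epsilon> i) = f (Suc i)"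
    by (elim exE)
  then have arc: "\<And>i. \<epsilon> i \<in> arcs E"
    and tail: "\<And>i. tail E (\<epsilon> i) = f i" and head: "\<And>i. head E (\<epsilon> i) = f (Suc i)"
    by simp_all
  have vert: "f i \<in> verts E" for i
    using arc[of i] tail[of i] graph by (auto simp: wf_digraph_def)
  have "f 0 \<notin> isolated_vertices E"
    using imageI[OF arc[of 0], of "tail E"] tail[of 0] by (simp add: isolated_vertices_def)
  then obtain i where i: "i \<in> \<Delta>" "f 0 \<in> Z i" using vert[of 0] cover by blast
  have Z: "f j \<in> Z i" for j
  proof (induction j)
    case (Suc j)
    have "undirected_path E (f (Suc j)) [f (Suc j), f j] [\<epsilon> j] (f j)"
      using arc[of j] tail[of j] head[of j] vert by (simp add: undirected_path_def joins_def)
    then have "path_between E (f (Suc j)) (f j)" unfolding path_between_def by blast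
    then show ?case
      using maximal[OF i(1)] Suc vert unfolding connected_maximal_def by blast
  qed (rule i(2))
  define G where "G = subgraph_on E (Z i)"
  obtain m where m: "Z i = (\<Union>n\<in>{1..m}. level G n) \<or>
      (\<exists>v. v \<notin> (\<Union>n\<in>{1..m}. level G n) \<and> Z i = (\<Union>n\<in>{1..m}. level G n) \<union> {v} \<and> \<not> loop_at E v)"
    using levels[OF i(1)] by (auto simp: G_def)
  have "f j \<in> verts (peel G m)" if "m \<le> j" for j
    by (rule infinite_path_survives_peel[where f = f and \<epsilon> = \<epsilon>, THEN conjunct1])
      (use Z arc tail head that in \<open>simp_all add: G_def subgraph_on_def\<close>)
  then have remaining: "f j \<in> Z i - (\<Union>n\<in>{1..m}. level G n)" if "m \<le> j" for j
    using that unfolding verts_peel by (simp add: G_def subgraph_on_def)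
  from m show False
  proof
    assume "Z i = (\<Union>n\<in>{1..m}. level G n)"
    then show False using remaining[of m] by blast
  next
    assume "\<exists>v. v \<notin> (\<Union>n\<in>{1..m}. level G n) \<and> Z i = (\<Union>n\<in>{1..m}. level G n) \<union> {v} \<and> \<not> loop_at E v"
    then obtain v where v: "Z i = (\<Union>n\<in>{1..m}. level G n) \<union> {v}" "\<not> loop_at E v" by blast
    then have "f m = v" "f (Suc m) = v" using remaining[of m] remaining[of "Suc m"] by auto
    then have "loop_at E v" using arc[of m] tail[of m] head[of m] by (auto simp: loop_at_def)
    with v(2) show False ..
  qed
qed

theorem theorem4p2:
  fixes E :: "('v, 'e) pre_digraph"
    and \<Delta> :: "'i set" and Z :: "'i \<Rightarrow> 'v set"
    and A :: "'a star_algebra" and P :: "'v \<Rightarrow> 'a" and S :: "'e \<Rightarrow> 'a"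
    and H :: "'h inner_space" and \<pi> :: "'a \<Rightarrow> 'h \<Rightarrow> 'h"
  assumes graph: "wf_digraph E" "countable (verts E)" "countable (arcs E)"
    and decomposition: "verts E = (\<Union>i\<in>\<Delta>. Z i) \<union> isolated_vertices E"
      "disjoint_family_on Z \<Delta>"
      "\<And>i. i \<in> \<Delta> \<Longrightarrow> connected_maximal E (Z i)"
      "\<And>i. i \<in> \<Delta> \<Longrightarrow> Z i \<subseteq> head E ` arcs E \<union> tail E ` arcs E"
    and levels: "\<And>i. i \<in> \<Delta> \<Longrightarrow> \<exists>m.
        Z i = (\<Union>n\<in>{1..m}. level (subgraph_on E (Z i)) n) \<or>
        (\<exists>v. v \<notin> (\<Union>n\<in>{1..m}. level (subgraph_on E (Z i)) n) \<and>
             Z i = (\<Union>n\<in>{1..m}. level (subgraph_on E (Z i)) n) \<union> {v} \<and>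
             \<not> loop_at E v)"
    and graph_algebra: "is_graph_cstar_algebra E A P S"
    and hilbert: "hilbert_space H" "separable H"
    and rep: "cstar_representation A H \<pi>"
  shows "\<exists>(X :: (real, 'v, 'e) branching_data) \<rho>.
           branching_system E X \<and>
           induced_representation E A P S X \<rho> \<and>
           unitarily_equivalent A H \<pi> (l2_space (bs_measure X)) \<rho>"
proof -
  interpret graph_representation H E A P S \<pi>
    using graph(1) graph_algebra hilbert(1) rep
    by (simp add: graph_representation_def graph_representation_axioms_def is_graph_cstar_algebra_def)
  have wf: "wf {(head E e, tail E e) | e. e \<in> arcs E}"
    by (rule finite_levels_imp_no_infinite_path[OF graph(1) decomposition(1,3) levels])
  have "\<forall>v\<in>verts E. \<exists>B. orthonormal_basis_of H (sink_space v) B"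
    by (intro ballI ex_basis_sink_space)
  from bchoice[OF this] obtain C
    where C: "\<forall>v\<in>verts E. orthonormal_basis_of H (sink_space v) (C v)" by (elim exE)
  from ex_basis_outer_space obtain B0 where B0: "orthonormal_basis_of H outer_space B0"
    by (elim exE)
  interpret path_basis H E A P S \<pi> C B0
    using wf C B0 by unfold_locales simp_all
  have cnt: "countable full_basis"
    using hilbert(2) full_basis_orthonormal by (rule orthonormal_countable)
  define g :: "'h \<Rightarrow> real" where "g b = real (to_nat_on full_basis b)" for b
  have inj: "inj_on g full_basis"
    using inj_on_to_nat_on[OF cnt] by (auto simp: g_def inj_on_def)
  obtain \<rho> where \<rho>: "induced_representation E A P S (basis_system g) \<rho>"
    "unitarily_equivalent A H \<pi> (l2_space (bs_measure (basis_system g))) \<rho>"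
    using equivalent_to_basis_system[OF hilbert(2) inj] by (elim exE conjE)
  show ?thesis
    by (rule exI[of _ "basis_system g"], rule exI[of _ \<rho>], intro conjI
        branching_system_basis_system[OF inj] \<rho>)
qed

end
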